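(* Let $m\ge 4$ be an even integer and let $n\ge 2$ be an integer. Then the fibration $\varepsilon_{m,S^n}$ does not have a (continuous) $\Sigma_m$-equivariant section.
   Context: For $m\ge 2$, $J_m$ is the space obtained from $m$ segments $I_i=[0,1]_i$ ($i=1,\dots,m$) by gluing them all together at $t=0$; the right end ($t=1$) of $I_i$ is denoted $1_i$. For a space $X$, $P_m(X)$ is the space of continuous maps $J_m\to X$ with the compact-open topology, and $e_{m,X}:P_m(X)\to X^{\times m}$ is the fibration $f\mapsto (f(1_1),\dots,f(1_m))$. The configuration space is $F_m(X)=\{(x_1,\dots,x_m)\in X^{\times m}: x_i\ne x_j \text{ for } i\neq j\}$. The fibration $\varepsilon_{m,X}: e_{m,X}^{-1}(F_m(X))\to F_m(X)$ is the restriction of $e_{m,X}$. The symmetric group $\Sigma_m$ acts on $X^{\times m}$ and $F_m(X)$ by permuting coordinates and on $P_m(X)$ by precomposition with the corresponding permutation of the branches of $J_m$; $e_{m,X}$ and $\varepsilon_{m,X}$ are equivariant. Explicitly, a $\Sigma_m$-equivariant section of $\varepsilon_{m,X}$ is a continuous map $s:F_m(X)\to P_m(X)$ with $s(x_1,\dots,x_m)(1_i)=x_i$ for all $i$ and $s(x_{\sigma(1)},\dots,x_{\sigma(m)})=s(x_1,\dots,x_m)\circ\hat\sigma$ for all $\sigma\in\Sigma_m$, where $\hat\sigma:J_m\to J_m$ sends the point with parameter $t$ on branch $i$ to the point with parameter $t$ on branch $\sigma(i)$. *)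

theory Defs
  imports "HOL-Analysis.Analysis"
begin

definition quotient_topology :: "'a topology \<Rightarrow> ('a \<Rightarrow> 'b) \<Rightarrow> 'b topology" where
  "quotient_topology X q =
     topology (\<lambda>U. U \<subseteq> q ` topspace X \<and> openin X {x \<in> topspace X. q x \<in> U})"

lemma openin_quotient_topology:
  "openin (quotient_topology X q) U \<longleftrightarrow>
     U \<subseteq> q ` topspace X \<and> openin X {x \<in> topspace X. q x \<in> U}"
proof -
  have "istopology (\<lambda>U. U \<subseteq> q ` topspace X \<and> openin X {x \<in> topspace X. q x \<in> U})"
    unfolding istopology_def
  proof (intro conjI allI impI)
    fix S T
    assume "S \<subseteq> q ` topspace X \<and> openin X {x \<in> topspace X. q x \<in> S}"
      and "T \<subseteq> q ` topspace X \<and> openin X {x \<in> topspace X. q x \<in> T}"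
    moreover have "{x \<in> topspace X. q x \<in> S \<inter> T}
        = {x \<in> topspace X. q x \<in> S} \<inter> {x \<in> topspace X. q x \<in> T}"
      by auto
    ultimately show "S \<inter> T \<subseteq> q ` topspace X" "openin X {x \<in> topspace X. q x \<in> S \<inter> T}"
      by auto
  next
    fix \<K>
    assume *: "\<forall>K\<in>\<K>. K \<subseteq> q ` topspace X \<and> openin X {x \<in> topspace X. q x \<in> K}"
    then show "\<Union>\<K> \<subseteq> q ` topspace X"
      by blast
    have "{x \<in> topspace X. q x \<in> \<Union>\<K>} = (\<Union>K\<in>\<K>. {x \<in> topspace X. q x \<in> K})"
      by auto
    then show "openin X {x \<in> topspace X. q x \<in> \<Union>\<K>}"
      using * by auto
  qed
  then show ?thesis
    by (simp add: quotient_topology_def)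
qed

lemma topspace_quotient_topology [simp]: "topspace (quotient_topology X q) = q ` topspace X"
proof -
  have "openin (quotient_topology X q) (q ` topspace X)"
    by (simp add: openin_quotient_topology Collect_conj_eq Int_absorb2 subset_eq)
  then show ?thesis
    by (meson openin_quotient_topology openin_subset openin_topspace subset_antisym)
qed

lemma quotient_map_quotient_topology: "quotient_map X (quotient_topology X q) q"
  by (auto simp: quotient_map_def openin_quotient_topology)

text \<open>The star \<open>J\<^sub>m\<close>. A point with parameter \<open>t > 0\<close> on branch \<open>i\<close> is represented by \<open>(i, t)\<close>,
  and the common point \<open>t = 0\<close> by \<open>(0, 0)\<close>; \<open>0\<close> is not the index of a branch.\<close>

definition branch_point :: "nat \<Rightarrow> real \<Rightarrow> nat \<times> real" where
  "branch_point i t = (if t = 0 then (0, 0) else (i, t))"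

lemma branch_point_eq_iff:
  "branch_point i t = branch_point j u \<longleftrightarrow> t = u \<and> (t = 0 \<or> i = j)"
  by (auto simp: branch_point_def)

definition star_space :: "nat \<Rightarrow> (nat \<times> real) topology" where
  "star_space m =
     quotient_topology (sum_topology (\<lambda>i. top_of_set {0..1}) {1..m}) (\<lambda>(i, t). branch_point i t)"

lemma topspace_star_space:
  "topspace (star_space m) = {branch_point i t | i t. i \<in> {1..m} \<and> t \<in> {0..1}}"
  by (force simp: star_space_def)

text \<open>As in \<^const>\<open>product_topology\<close>, functions are normalised to be \<^const>\<open>undefined\<close> outside
  \<open>topspace J\<close>, so that each continuous map from \<open>J\<close> to \<open>X\<close> is a single point.\<close>

definition compact_open_topology :: "'a topology \<Rightarrow> 'b topology \<Rightarrow> ('a \<Rightarrow> 'b) topology" where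
  "compact_open_topology J X =
     topology_generated_by
       {{f \<in> extensional (topspace J). continuous_map J X f \<and> f ` K \<subseteq> U} | K U.
          compactin J K \<and> openin X U}"

lemma topspace_compact_open_topology:
  "topspace (compact_open_topology J X) = {f \<in> extensional (topspace J). continuous_map J X f}"
proof -
  have "compactin J {}" "openin X {}"
    by auto
  then show ?thesis
    unfolding compact_open_topology_def topology_generated_by_topspace by blast
qed

definition multipath_space :: "nat \<Rightarrow> 'a topology \<Rightarrow> (nat \<times> real \<Rightarrow> 'a) topology" where
  "multipath_space m X = compact_open_topology (star_space m) X"

definition cartesian_power :: "nat \<Rightarrow> 'a topology \<Rightarrow> (nat \<Rightarrow> 'a) topology" where
  "cartesian_power m X = product_topology (\<lambda>i. X) {1..m}"

definition configuration_space :: "nat \<Rightarrow> 'a topology \<Rightarrow> (nat \<Rightarrow> 'a) topology" where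
  "configuration_space m X = subtopology (cartesian_power m X) {x. inj_on x {1..m}}"

definition endpoint_map :: "nat \<Rightarrow> (nat \<times> real \<Rightarrow> 'a) \<Rightarrow> nat \<Rightarrow> 'a" where
  "endpoint_map m f = (\<lambda>i\<in>{1..m}. f (branch_point i 1))"

definition eps_total_space :: "nat \<Rightarrow> 'a topology \<Rightarrow> (nat \<times> real \<Rightarrow> 'a) topology" where
  "eps_total_space m X =
     subtopology (multipath_space m X)
       {f. endpoint_map m f \<in> topspace (configuration_space m X)}"

text \<open>The fibration \<open>\<epsilon>\<close> is \<^const>\<open>endpoint_map\<close> \<open>m\<close> on \<^const>\<open>eps_total_space\<close> \<open>m X\<close>.\<close>

text \<open>The action of \<open>\<Sigma>\<^sub>m\<close>, that is, of all \<open>\<sigma>\<close> with \<open>\<sigma> permutes {1..m}\<close>.\<close>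

definition permute_coords :: "(nat \<Rightarrow> nat) \<Rightarrow> (nat \<Rightarrow> 'a) \<Rightarrow> nat \<Rightarrow> 'a" where
  "permute_coords \<sigma> x = (\<lambda>i. x (\<sigma> i))"

definition permute_branches :: "(nat \<Rightarrow> nat) \<Rightarrow> nat \<times> real \<Rightarrow> nat \<times> real" where
  "permute_branches \<sigma> = (\<lambda>(i, t). branch_point (\<sigma> i) t)"

definition permute_multipath ::
  "nat \<Rightarrow> (nat \<Rightarrow> nat) \<Rightarrow> (nat \<times> real \<Rightarrow> 'a) \<Rightarrow> nat \<times> real \<Rightarrow> 'a" where
  "permute_multipath m \<sigma> f = restrict (f \<circ> permute_branches \<sigma>) (topspace (star_space m))"

lemma permute_branches_branch_point [simp]:
  "permute_branches \<sigma> (branch_point i t) = branch_point (\<sigma> i) t"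
  by (simp add: permute_branches_def branch_point_def)

lemma permute_coords_in_configuration_space:
  assumes "\<sigma> permutes {1..m}" "x \<in> topspace (configuration_space m X)"
  shows "permute_coords \<sigma> x \<in> topspace (configuration_space m X)"
proof -
  have x: "x \<in> {1..m} \<rightarrow>\<^sub>E topspace X" "inj_on x {1..m}"
    using assms(2) by (auto simp: configuration_space_def cartesian_power_def)
  have "permute_coords \<sigma> x \<in> {1..m} \<rightarrow>\<^sub>E topspace X"
    using x(1) assms(1) permutes_in_image[OF assms(1)] permutes_not_in[OF assms(1)]
    by (auto simp: permute_coords_def PiE_iff extensional_def)
  moreover have "inj_on (permute_coords \<sigma> x) {1..m}"
    using comp_inj_on[of \<sigma> "{1..m}" x] x(2) permutes_inj_on[OF assms(1)] permutes_image[OF assms(1)]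
    by (simp add: permute_coords_def comp_def)
  ultimately show ?thesis
    by (simp add: configuration_space_def cartesian_power_def)
qed

lemma continuous_map_permute_branches:
  assumes "\<sigma> permutes {1..m}"
  shows "continuous_map (star_space m) (star_space m) (permute_branches \<sigma>)"
proof -
  let ?D = "sum_topology (\<lambda>i. top_of_set {0..1::real}) {1..m}"
  let ?q = "\<lambda>(i, t). branch_point i t"
  have q: "quotient_map ?D (star_space m) ?q"
    unfolding star_space_def by (rule quotient_map_quotient_topology)
  have \<sigma>: "\<sigma> i \<in> {1..m} \<longleftrightarrow> i \<in> {1..m}" for i
    using permutes_in_image[OF assms] .
  have "continuous_map ?D ?D (\<lambda>(i, t). (\<sigma> i, t))"
    unfolding continuous_map_def
  proof (intro conjI allI impI)
    show "(\<lambda>(i, t). (\<sigma> i, t)) \<in> topspace ?D \<rightarrow> topspace ?D"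
      by (rule funcsetI) (clarsimp simp: \<sigma> simp del: atLeastAtMost_iff One_nat_def)
    fix U assume "openin ?D U"
    then have U: "U \<subseteq> Sigma {1..m} (\<lambda>i. {0..1})"
      "\<And>i. i \<in> {1..m} \<Longrightarrow> openin (top_of_set {0..1}) {x. (i, x) \<in> U}"
      by (auto simp: openin_sum_topology comp_def)
    let ?V = "{p \<in> topspace ?D. (case p of (i, t) \<Rightarrow> (\<sigma> i, t)) \<in> U}"
    have "openin (top_of_set {0..1}) {x. (i, x) \<in> ?V}" if i: "i \<in> {1..m}" for i
    proof -
      have "{x. (i, x) \<in> ?V} = {x. (\<sigma> i, x) \<in> U}"
        using i U(1) by auto
      moreover have "\<sigma> i \<in> {1..m}"
        using i \<sigma> by blast
      ultimately show ?thesis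
        using U(2) by presburger
    qed
    moreover have "?V \<subseteq> Sigma {1..m} (topspace \<circ> (\<lambda>i. top_of_set {0..1}))"
      by auto
    ultimately show "openin ?D ?V"
      unfolding openin_sum_topology by blast
  qed
  then have "continuous_map ?D (star_space m) (?q \<circ> (\<lambda>(i, t). (\<sigma> i, t)))"
    using quotient_imp_continuous_map[OF q] by (rule continuous_map_compose)
  moreover have "?q \<circ> (\<lambda>(i, t). (\<sigma> i, t)) = permute_branches \<sigma> \<circ> ?q"
    by auto
  ultimately show ?thesis
    using continuous_compose_quotient_map[OF q] by metis
qed

lemma permute_multipath_in_multipath_space:
  assumes "\<sigma> permutes {1..m}" "f \<in> topspace (multipath_space m X)"
  shows "permute_multipath m \<sigma> f \<in> topspace (multipath_space m X)"
proof -
  have "continuous_map (star_space m) X (f \<circ> permute_branches \<sigma>)"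
    using continuous_map_permute_branches[OF assms(1)] assms(2)
    by (auto simp: multipath_space_def topspace_compact_open_topology intro: continuous_map_compose)
  then have "continuous_map (star_space m) X (permute_multipath m \<sigma> f)"
    by (rule continuous_map_eq) (simp add: permute_multipath_def)
  then show ?thesis
    by (simp add: multipath_space_def topspace_compact_open_topology permute_multipath_def)
qed

lemma endpoint_map_permute_multipath:
  assumes "\<sigma> permutes {1..m}"
  shows "endpoint_map m (permute_multipath m \<sigma> f) = permute_coords \<sigma> (endpoint_map m f)"
proof
  fix i
  have "branch_point i 1 \<in> topspace (star_space m)" if "i \<in> {1..m}"
    using that by (force simp: topspace_star_space)
  then show "endpoint_map m (permute_multipath m \<sigma> f) i = permute_coords \<sigma> (endpoint_map m f) i"
    using permutes_in_image[OF assms, of i]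
    by (simp add: endpoint_map_def permute_multipath_def permute_coords_def del: atLeastAtMost_iff)
qed

definition eps_equivariant_section ::
  "nat \<Rightarrow> 'a topology \<Rightarrow> ((nat \<Rightarrow> 'a) \<Rightarrow> nat \<times> real \<Rightarrow> 'a) \<Rightarrow> bool" where
  "eps_equivariant_section m X s \<longleftrightarrow>
     continuous_map (configuration_space m X) (eps_total_space m X) s \<and>
     (\<forall>x \<in> topspace (configuration_space m X). endpoint_map m (s x) = x) \<and>
     (\<forall>\<sigma>. \<sigma> permutes {1..m} \<longrightarrow>
        (\<forall>x \<in> topspace (configuration_space m X).
           s (permute_coords \<sigma> x) = permute_multipath m \<sigma> (s x)))"

end

theory Submission
  imports Defs "HOL-Homology.Homology"
begin

text \<open>Write \<open>n = k + 1\<close>. A point \<open>y = (a, b)\<close> of \<open>S\<^sup>k\<close> and \<open>u \<in> [0,1]\<close> give orthonormal vectors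
  \<open>x = (a, b cos \<pi>u, b sin \<pi>u)\<close> and \<open>v = (0, - sin \<pi>u, cos \<pi>u)\<close>, and the vertices of the regular
  \<open>m\<close>-gon in their span that starts at \<open>x\<close> form a configuration. A section moves along the first
  branch from the image of the centre of the star, a map \<open>f\<close> of \<open>(u, y)\<close>, to the map
  \<open>p (u, y) = x\<close>. Since \<open>v \<mapsto> - v\<close> permutes the vertices and fixes the first one, the homotopy
  descends to the closed manifold obtained from \<open>[0,1] \<times> S\<^sup>k\<close> by identifying \<open>(1, (a, b))\<close> with
  \<open>(0, (a, - b))\<close>. As \<open>m\<close> is even, \<open>x \<mapsto> - x\<close> permutes the vertices as well, so that \<open>f\<close> is
  invariant under the free involution \<open>y \<mapsto> - y\<close> and has even degree, whereas \<open>p\<close> has odd degree.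
  The manifold need not be orientable, so degrees are taken modulo 2; in terms of integral chains
  this means to work with classes in \<open>H\<^sub>n(S\<^sup>n)\<close> up to doubles.\<close>

subsection \<open>The prism operator\<close>

abbreviation unit_interval :: "real topology" where
  "unit_interval \<equiv> top_of_set {0..1}"

abbreviation simplex_space :: "nat \<Rightarrow> (nat \<Rightarrow> real) topology" where
  "simplex_space p \<equiv> subtopology (powertop_real UNIV) (standard_simplex p)"

abbreviation id_simplex :: "nat \<Rightarrow> (nat \<Rightarrow> real) \<Rightarrow> nat \<Rightarrow> real" where
  "id_simplex p \<equiv> restrict id (standard_simplex p)"

lemma singular_simplex_id_simplex: "singular_simplex p (simplex_space p) (id_simplex p)"
  unfolding singular_simplex_def
  by (auto intro: continuous_map_eq[OF continuous_map_id])

text \<open>The contraction makes \<open>c\<close> homologous to its image under a constant map, a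
  cycle of a one-point space. In positive degree every such cycle is a boundary; this is where
  \<open>1 \<le> p\<close> enters.\<close>

lemma contractible_imp_cycle_boundary:
  assumes "contractible_space X" "1 \<le> p" "singular_relcycle p X {} c"
  shows "singular_relboundary p X {} c"
proof (cases "topspace X = {}")
  case True
  then show ?thesis
    using assms(3) by (simp add: singular_cycle singular_chain_empty)
next
  case False
  obtain a where hom: "homotopic_with (\<lambda>x. True) X X id (\<lambda>x. a)"
    using assms(1) by (auto simp: contractible_space_def)
  have a: "a \<in> topspace X"
    using homotopic_with_imp_continuous_maps[OF hom] False by (auto simp: continuous_map_def)
  have "homologous_rel p X {} (chain_map p id c) (chain_map p (\<lambda>x. a) c)"
    by (rule homotopic_imp_homologous_rel_chain_maps[OF _ assms(3)]) (use hom in simp)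
  then have 1: "homologous_rel p X {} c (chain_map p (\<lambda>x. a) c)"
    using assms(3) by (metis chain_map_ident singular_cycle)
  have "singular_relcycle p (subtopology X {a}) {} (chain_map p (\<lambda>x. a) c)"
    by (rule singular_relcycle_chain_map[OF assms(3)]) (use a in auto)
  then have "singular_relboundary p (subtopology X {a}) {} (chain_map p (\<lambda>x. a) c)"
    using singular_boundary_eq_cycle_singleton[of "subtopology X {a}" a p] a assms(2) by simp
  then have "singular_relboundary p X {} (chain_map p (\<lambda>x. a) c)"
    by (metis singular_boundary_mono subset_UNIV subtopology_UNIV)
  from singular_relboundary_add[OF 1[unfolded homologous_rel_def] this] show ?thesis
    by simp
qed

lemma contractible_space_simplex_space: "contractible_space (simplex_space p)"
proof -
  let ?v = "(\<lambda>j. if j = 0 then 1 else 0) :: nat \<Rightarrow> real"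
  let ?h = "\<lambda>z i. (1 - fst z) * snd z i + fst z * ?v i"
  have "continuous_map (prod_topology unit_interval (simplex_space p)) (powertop_real UNIV) ?h"
    unfolding continuous_map_componentwise_UNIV
  proof
    fix i
    have 1: "continuous_map (prod_topology unit_interval (simplex_space p)) euclideanreal fst"
      using continuous_map_fst continuous_map_in_subtopology by blast
    have "continuous_map (simplex_space p) euclideanreal (\<lambda>x. x i)"
      by (intro continuous_map_from_subtopology continuous_map_product_projection) auto
    then have 2: "continuous_map (prod_topology unit_interval (simplex_space p)) euclideanreal (\<lambda>z. snd z i)"
      by (rule continuous_map_compose[OF continuous_map_snd, unfolded o_def])
    show "continuous_map (prod_topology unit_interval (simplex_space p)) euclideanreal (\<lambda>x. ?h x i)"
      by (intro continuous_intros 1 2)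
  qed
  moreover have "?h z \<in> standard_simplex p" if "z \<in> topspace (prod_topology unit_interval (simplex_space p))" for z
    using that by (intro convex_standard_simplex) auto
  ultimately have "continuous_map (prod_topology unit_interval (simplex_space p)) (simplex_space p) ?h"
    by (auto simp: continuous_map_in_subtopology)
  then have "homotopic_with (\<lambda>x. True) (simplex_space p) (simplex_space p) id (\<lambda>x. ?v)"
    unfolding homotopic_with_def by (intro exI[of _ ?h]) auto
  then show ?thesis
    unfolding contractible_space_def by blast
qed

lemma contractible_space_prism_space:
  "contractible_space (prod_topology unit_interval (simplex_space p))"
  by (simp add: contractible_space_prod_topology contractible_space_simplex_space
      contractible_space_top_of_set convex_imp_contractible is_interval_convex_1)

text \<open>The prism operator by the method of acyclic models: \<open>prism_model p\<close> is the value on the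
  identity simplex, and exists because \<open>[0,1] \<times> \<Delta>\<^sup>p\<close> is contractible.\<close>

definition prism_with :: "nat \<Rightarrow> (real \<times> (nat \<Rightarrow> real)) chain \<Rightarrow> 'a chain \<Rightarrow> (real \<times> 'a) chain" where
  "prism_with p d = frag_extend (\<lambda>\<sigma>. chain_map (Suc p) (map_prod id \<sigma>) d)"

text \<open>\<open>prism_with\<close> takes the model as an argument so that the recursion can use
  the operator of degree \<open>p\<close> before \<open>prism\<close> is defined. The prescribed
  boundary is the chain homotopy formula on the identity simplex; in degree 0 its last term is
  absent because a 0-chain has boundary 0.\<close>

primrec prism_model :: "nat \<Rightarrow> (real \<times> (nat \<Rightarrow> real)) chain" where
  "prism_model 0 = (SOME d. singular_chain (Suc 0) (prod_topology unit_interval (simplex_space 0)) d \<and>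
      chain_boundary (Suc 0) d = chain_map 0 (Pair 1) (frag_of (id_simplex 0))
         - chain_map 0 (Pair 0) (frag_of (id_simplex 0)))"
| "prism_model (Suc p) =
    (SOME d. singular_chain (Suc (Suc p)) (prod_topology unit_interval (simplex_space (Suc p))) d \<and>
      chain_boundary (Suc (Suc p)) d = chain_map (Suc p) (Pair 1) (frag_of (id_simplex (Suc p)))
         - chain_map (Suc p) (Pair 0) (frag_of (id_simplex (Suc p)))
         - prism_with p (prism_model p) (chain_boundary (Suc p) (frag_of (id_simplex (Suc p)))))"

definition prism :: "nat \<Rightarrow> 'a chain \<Rightarrow> (real \<times> 'a) chain" where
  "prism p = prism_with p (prism_model p)"

lemma prism_0 [simp]: "prism p 0 = 0"
  by (simp add: prism_def prism_with_def)

lemma prism_minus: "prism p (- a) = - prism p a"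
  by (simp add: prism_def prism_with_def frag_extend_minus)

lemma prism_diff: "prism p (a - b) = prism p a - prism p b"
  by (simp add: prism_def prism_with_def frag_extend_diff)

lemma prism_cmul: "prism p (frag_cmul r a) = frag_cmul r (prism p a)"
  by (simp add: prism_def prism_with_def frag_extend_cmul)

lemma prism_of: "prism p (frag_of \<sigma>) = chain_map (Suc p) (map_prod id \<sigma>) (prism_model p)"
  by (simp add: prism_def prism_with_def)

lemma continuous_map_Pair_right: "a \<in> topspace Y \<Longrightarrow> continuous_map X (prod_topology Y X) (Pair a)"
  by (simp add: continuous_map_pairwise o_def)

lemma continuous_map_map_prod_id:
  "continuous_map X Y f \<Longrightarrow> continuous_map (prod_topology Z X) (prod_topology Z Y) (map_prod id f)"
  unfolding map_prod_def case_prod_unfold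
  by (intro continuous_map_pairedI) (auto simp: continuous_map_fst continuous_map_snd
      intro: continuous_map_compose[OF continuous_map_snd, unfolded o_def])

text \<open>The property of \<open>prism_model\<close> stays a hypothesis here and in the next two
  lemmas, since they serve inside the induction that establishes it.\<close>

lemma prism_chain_if:
  assumes d: "singular_chain (Suc p) (prod_topology unit_interval (simplex_space p)) (prism_model p)"
    and c: "singular_chain p X c"
  shows "singular_chain (Suc p) (prod_topology unit_interval X) (prism p c)"
  unfolding prism_def prism_with_def
proof (rule singular_chain_extend)
  fix \<sigma> assume "\<sigma> \<in> Poly_Mapping.keys c"
  then have "continuous_map (simplex_space p) X \<sigma>"
    using c by (auto simp: singular_chain_def singular_simplex_def)
  then show "singular_chain (Suc p) (prod_topology unit_interval X)
      (chain_map (Suc p) (map_prod id \<sigma>) (prism_model p))"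
    by (intro singular_chain_chain_map[OF d] continuous_map_map_prod_id)
qed

lemma prism_natural_if:
  assumes d: "singular_chain (Suc p) (prod_topology unit_interval (simplex_space p)) (prism_model p)"
  shows "prism p (chain_map p g c) = chain_map (Suc p) (map_prod id g) (prism p c)"
  using subset_UNIV
proof (induction c rule: frag_induction)
  case (one \<sigma>)
  have "chain_map (Suc p) (map_prod id (simplex_map p g \<sigma>)) (prism_model p)
      = chain_map (Suc p) (map_prod id g \<circ> map_prod id \<sigma>) (prism_model p)"
    by (rule chain_map_eq[OF d]) (auto simp: simplex_map_def)
  then show ?case
    unfolding chain_map_of prism_of by (simp only: chain_map_compose comp_apply)
qed (auto simp: chain_map_diff prism_diff simp del: id_apply)

text \<open>By naturality, the boundary formula need only be known on the model simplex.\<close>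

lemma prism_boundary_if:
  fixes c :: "'a chain"
  assumes d: "singular_chain (Suc p) (prod_topology unit_interval (simplex_space p)) (prism_model p)"
    and d': "p > 0 \<Longrightarrow> singular_chain p (prod_topology unit_interval (simplex_space (p - 1))) (prism_model (p - 1))"
    and bd: "chain_boundary (Suc p) (prism_model p) = chain_map p (Pair 1) (frag_of (id_simplex p))
         - chain_map p (Pair 0) (frag_of (id_simplex p))
         - prism (p - 1) (chain_boundary p (frag_of (id_simplex p)))"
    and c: "singular_chain p X c"
  shows "chain_boundary (Suc p) (prism p c) =
    chain_map p (Pair 1) c - chain_map p (Pair 0) c - prism (p - 1) (chain_boundary p c)"
  using c unfolding singular_chain_def
proof (induction c rule: frag_induction)
  case (one \<sigma>)
  then have \<sigma>: "singular_simplex p X \<sigma>" by simp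
  have eq: "chain_map p \<sigma> (frag_of (id_simplex p)) = frag_of \<sigma>"
    by (rule singular_simplex_chain_map_id[OF \<sigma>])
  have *: "chain_map p (map_prod id \<sigma>) (chain_map p (Pair a) (frag_of (id_simplex p)))
        = chain_map p (Pair a) (frag_of \<sigma>)" for a :: real
  proof -
    have "map_prod id \<sigma> \<circ> Pair a = Pair a \<circ> \<sigma>" by auto
    then show ?thesis
      by (metis chain_map_compose comp_apply eq)
  qed
  have nat: "chain_map p (map_prod id \<sigma>) (prism (p - 1) (chain_boundary p (frag_of (id_simplex p))))
      = prism (p - 1) (chain_boundary p (frag_of \<sigma>))"
  \<comment> \<open>In degree 0 the index \<open>p - 1\<close> is truncated to 0, but the boundary
    is 0 there and both sides vanish.\<close>
  proof (cases "p = 0")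
    case True
    then show ?thesis by (simp add: chain_boundary_def)
  next
    case False
    have "chain_boundary p (frag_of \<sigma>) = chain_map (p - 1) \<sigma> (chain_boundary p (frag_of (id_simplex p)))"
      using chain_boundary_chain_map[of p "simplex_space p" "frag_of (id_simplex p)" \<sigma>]
      by (simp add: eq singular_chain_of singular_simplex_id_simplex del: chain_map_of)
    with False d' show ?thesis
      using prism_natural_if[of "p - 1" \<sigma> "chain_boundary p (frag_of (id_simplex p))"] by simp
  qed
  show ?case
    unfolding prism_of using chain_boundary_chain_map[OF d, of "map_prod id \<sigma>"]
    by (simp add: bd chain_map_diff * nat[simplified] del: chain_map_of)
next
  case (diff a b)
  then show ?case
    by (simp add: prism_diff chain_boundary_diff chain_map_diff)
qed auto

text \<open>Strong induction is used because the boundary of \<open>?r\<close> is computed from the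
  formula in degree \<open>p\<close>, which itself refers to the model of degree
  \<open>p - 1\<close>. Once \<open>?r\<close> is a cycle, contractibility of the prism fills it, so
  the choice made in the definition is justified.\<close>

lemma prism_model:
  "singular_chain (Suc p) (prod_topology unit_interval (simplex_space p)) (prism_model p) \<and>
   chain_boundary (Suc p) (prism_model p) = chain_map p (Pair 1) (frag_of (id_simplex p))
         - chain_map p (Pair 0) (frag_of (id_simplex p))
         - prism (p - 1) (chain_boundary p (frag_of (id_simplex p)))"
proof (induction p rule: less_induct)
  case (less q)
  show ?case
  proof (cases q)
    case 0
    let ?Y = "prod_topology unit_interval (simplex_space 0)"
    \<comment> \<open>The contractibility argument needs positive degree, so in degree 0 the two end
      inclusions are joined directly, the homotopy being the identity of the prism.\<close>
    have "homotopic_with (\<lambda>h. True) (simplex_space 0) ?Y (Pair 1) (Pair 0)"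
    proof -
      have "homotopic_with (\<lambda>h. True) (simplex_space 0) ?Y (Pair 0) (Pair 1)"
        unfolding homotopic_with_def by (rule exI[of _ id]) auto
      then show ?thesis
        by (rule homotopic_with_symD)
    qed
    then have "homologous_rel 0 ?Y {} (chain_map 0 (Pair 1) (frag_of (id_simplex 0)))
        (chain_map 0 (Pair 0) (frag_of (id_simplex 0)))"
      by (intro homotopic_imp_homologous_rel_chain_maps[where S = "simplex_space 0" and T = "{}"])
         (auto simp: singular_cycle singular_chain_of singular_simplex_id_simplex chain_boundary_def)
    then have "\<exists>d. singular_chain (Suc 0) ?Y d \<and>
        chain_boundary (Suc 0) d = chain_map 0 (Pair 1) (frag_of (id_simplex 0))
           - chain_map 0 (Pair 0) (frag_of (id_simplex 0))"
      unfolding homologous_rel_def singular_boundary by blast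
    from someI_ex[OF this] show ?thesis
      unfolding 0 prism_model.simps chain_boundary_def[of 0] by (simp only: prism_0 if_True diff_zero simp_thms)
  next
    case (Suc p)
    let ?Y = "prod_topology unit_interval (simplex_space (Suc p))"
    note IH = less.IH[of p, unfolded Suc, OF lessI]
    let ?i = "frag_of (id_simplex (Suc p))"
    let ?b = "chain_boundary (Suc p) ?i"
    let ?r = "chain_map (Suc p) (Pair 1) ?i - chain_map (Suc p) (Pair 0) ?i - prism p ?b"
    have i: "singular_chain (Suc p) (simplex_space (Suc p)) ?i"
      by (simp add: singular_chain_of singular_simplex_id_simplex)
    then have b: "singular_chain p (simplex_space (Suc p)) ?b"
      by (rule singular_chain_boundary_alt)
    have cont: "continuous_map (simplex_space (Suc p)) ?Y (Pair a)" if "a \<in> {0..1}" for a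
      using that by (intro continuous_map_Pair_right) auto
    have r: "singular_chain (Suc p) ?Y ?r"
      using IH b i by (intro singular_chain_diff singular_chain_chain_map[OF i] cont prism_chain_if) auto
    have d': "singular_chain p (prod_topology unit_interval (simplex_space (p - 1))) (prism_model (p - 1))"
      if "p > 0"
      using less.IH[of "p - 1"] Suc that by simp
    have "chain_boundary (Suc p) (prism p ?b) =
       chain_map p (Pair 1) ?b - chain_map p (Pair 0) ?b - prism (p - 1) (chain_boundary p ?b)"
      by (rule prism_boundary_if[OF conjunct1[OF IH] d' conjunct2[OF IH] b])
    moreover have "chain_boundary p ?b = 0"
      using chain_boundary_boundary_alt[OF i] .
    moreover have "chain_boundary (Suc p) (chain_map (Suc p) (Pair a) ?i) = chain_map p (Pair a) ?b" for a :: real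
      using chain_boundary_chain_map[OF i, of "Pair a"] by simp
    \<comment> \<open>The end terms cancel against those in the boundary of
      \<open>prism p ?b\<close>; what is left is the prism of a double boundary.\<close>
    ultimately have "chain_boundary (Suc p) ?r = 0"
      by (simp add: chain_boundary_diff del: chain_map_of)
    then have "singular_relboundary (Suc p) ?Y {} ?r"
      using r by (intro contractible_imp_cycle_boundary contractible_space_prism_space)
        (auto simp: singular_cycle)
    then have "\<exists>d. singular_chain (Suc (Suc p)) ?Y d \<and> chain_boundary (Suc (Suc p)) d = ?r"
      unfolding singular_boundary .
    from someI_ex[OF this] show ?thesis
      unfolding Suc prism_model.simps prism_def diff_Suc_1 .
  qed
qed

lemma singular_chain_prism:
  "singular_chain p X c \<Longrightarrow> singular_chain (Suc p) (prod_topology unit_interval X) (prism p c)"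
  using prism_model prism_chain_if by blast

lemma chain_map_prism:
  "chain_map (Suc p) (map_prod id g) (prism p c) = prism p (chain_map p g c)"
  using prism_model prism_natural_if by metis

lemma chain_boundary_prism:
  assumes "singular_chain p X c"
  shows "chain_boundary (Suc p) (prism p c) =
    chain_map p (Pair 1) c - chain_map p (Pair 0) c - prism (p - 1) (chain_boundary p c)"
proof (rule prism_boundary_if[OF _ _ _ assms])
  show "singular_chain p (prod_topology unit_interval (simplex_space (p - 1))) (prism_model (p - 1))"
    if "p > 0"
    using prism_model[of "p - 1"] that by simp
qed (rule conjunct1[OF prism_model] conjunct2[OF prism_model])+

subsection \<open>Spheres as unions of orthants\<close>

lemma chain_map_comp: "chain_map p (h \<circ> g) c = chain_map p h (chain_map p g c)"
  by (simp only: chain_map_compose comp_apply)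

text \<open>On \<open>nsphere k\<close>, \<open>flip {..k}\<close> is the antipodal map and
  \<open>flip {k}\<close> the reflection in the last coordinate.\<close>

definition flip :: "nat set \<Rightarrow> (nat \<Rightarrow> real) \<Rightarrow> nat \<Rightarrow> real" where
  "flip T x = (\<lambda>i. if i \<in> T then - x i else x i)"

text \<open>Radial projection carries the standard simplex onto the part of the sphere with
  nonnegative coordinates; \<open>T\<close> then selects the orthant.\<close>

definition orthant_simplex :: "nat \<Rightarrow> nat set \<Rightarrow> (nat \<Rightarrow> real) \<Rightarrow> nat \<Rightarrow> real" where
  "orthant_simplex k T = (\<lambda>x\<in>standard_simplex k. flip T (\<lambda>i. x i / sqrt (\<Sum>j\<le>k. (x j)\<^sup>2)))"

text \<open>The signs orient the orthants coherently. As \<open>T\<close> avoids \<open>k\<close>,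
  only the upper hemisphere is covered; \<open>sphere_chain\<close> is the corresponding fundamental
  cycle of the whole sphere.\<close>

definition upper_chain :: "nat \<Rightarrow> (nat \<Rightarrow> real) chain" where
  "upper_chain k = (\<Sum>T\<in>Pow {..<k}. frag_cmul ((-1) ^ card T) (frag_of (orthant_simplex k T)))"

definition sphere_chain :: "nat \<Rightarrow> (nat \<Rightarrow> real) chain" where
  "sphere_chain k = (\<Sum>T\<in>Pow {..k}. frag_cmul ((-1) ^ card T) (frag_of (orthant_simplex k T)))"

lemma topspace_nsphere: "topspace (nsphere k) = {x. (\<Sum>i\<le>k. (x i)\<^sup>2) = 1 \<and> (\<forall>i>k. x i = 0)}"
  by (simp add: nsphere)

lemma continuous_map_into_nsphere:
  assumes "\<And>i. continuous_map X euclideanreal (\<lambda>x. f x i)"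
    and "\<And>x. x \<in> topspace X \<Longrightarrow> f x \<in> topspace (nsphere k)"
  shows "continuous_map X (nsphere k) f"
  using assms unfolding topspace_nsphere unfolding nsphere
  by (auto simp: continuous_map_in_subtopology continuous_map_componentwise_UNIV)

lemma continuous_map_flip: "continuous_map (nsphere k) (nsphere k) (flip T)"
proof -
  have "continuous_map (nsphere k) euclideanreal (\<lambda>x. flip T x i)" for i
    unfolding flip_def using continuous_map_nsphere_projection
    by (cases "i \<in> T") (auto intro!: continuous_intros continuous_map_minus)
  then show ?thesis
    by (rule continuous_map_into_nsphere)
      (auto simp: topspace_nsphere flip_def if_distrib[of "\<lambda>x. x\<^sup>2"] cong: if_cong)
qed

lemma flip_flip: "flip S (flip T x) = flip (sym_diff S T) x"
  by (auto simp: flip_def)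

lemma flip_empty [simp]: "flip {} = id"
  by (auto simp: flip_def)

lemma standard_simplex_sum_squares:
  assumes "x \<in> standard_simplex k"
  shows "(\<Sum>j\<le>k. (x j)\<^sup>2) > 0"
proof (rule ccontr)
  assume "\<not> ?thesis"
  then have "(\<Sum>j\<le>k. (x j)\<^sup>2) = 0"
    by (meson not_less order_antisym sum_nonneg zero_le_power2)
  then have "\<forall>j\<le>k. x j = 0"
    by (simp add: sum_nonneg_eq_0_iff)
  then show False
    using assms by (simp add: standard_simplex_def)
qed

lemma orthant_simplex_eq_flip:
  "orthant_simplex k T = simplex_map k (flip T) (orthant_simplex k {})"
  by (auto simp: orthant_simplex_def simplex_map_def)

lemma singular_orthant_simplex: "singular_simplex k (nsphere k) (orthant_simplex k T)"
proof -
  let ?f = "\<lambda>x i. x i / sqrt (\<Sum>j\<le>k. (x j)\<^sup>2) :: real"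
  have pr: "continuous_map (simplex_space k) euclideanreal (\<lambda>x. x i)" for i
    by (intro continuous_map_from_subtopology continuous_map_product_projection) auto
  have "continuous_map (simplex_space k) euclideanreal (\<lambda>x. ?f x i)" for i
    using standard_simplex_sum_squares
    by (intro continuous_map_real_divide continuous_map_sqrt continuous_map_sum continuous_intros pr) force+
  moreover have "?f x \<in> topspace (nsphere k)" if "x \<in> standard_simplex k" for x
    using that standard_simplex_sum_squares[OF that]
    by (simp add: nsphere power_divide standard_simplex_def flip: sum_divide_distrib)
  ultimately have "continuous_map (simplex_space k) (nsphere k) ?f"
    by (intro continuous_map_into_nsphere) auto
  then have "singular_simplex k (nsphere k) (orthant_simplex k {})"
    unfolding singular_simplex_def orthant_simplex_def
    by (auto intro: continuous_map_eq)
  then show ?thesis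
    by (subst orthant_simplex_eq_flip) (rule singular_simplex_simplex_map[OF _ continuous_map_flip])
qed

lemma simplex_map_flip_orthant:
  "simplex_map k (flip S) (orthant_simplex k T) = orthant_simplex k (sym_diff S T)"
  by (auto simp: orthant_simplex_def simplex_map_def flip_flip)

text \<open>The subsets of \<open>{..k}\<close> are split by whether they contain \<open>k\<close>;
  adjoining \<open>k\<close> changes the sign and reflects the orthant into the lower
  hemisphere.\<close>

lemma sphere_chain_eq: "sphere_chain k = upper_chain k - chain_map k (flip {k}) (upper_chain k)"
proof -
  have disj: "Pow {..<k} \<inter> insert k ` Pow {..<k} = {}" by auto
  have inj: "inj_on (insert k) (Pow {..<k})"
    by (rule inj_onI) (metis Diff_insert_absorb PowD lessThan_iff less_irrefl subsetD insert_ident)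
  have *: "{..k} = insert k {..<k}" by auto
  have **: "sym_diff {k} T = insert k T" "card (insert k T) = Suc (card T)" if "T \<in> Pow {..<k}" for T
  proof -
    have "k \<notin> T" "finite T" using that finite_subset by auto
    then show "sym_diff {k} T = insert k T" "card (insert k T) = Suc (card T)" by auto
  qed
  have "sphere_chain k = upper_chain k
     + (\<Sum>T\<in>Pow {..<k}. frag_cmul ((-1) ^ card (insert k T)) (frag_of (orthant_simplex k (insert k T))))"
    unfolding sphere_chain_def upper_chain_def * Pow_insert
    by (subst sum.union_disjoint) (use disj inj in \<open>auto simp: sum.reindex\<close>)
  also have "(\<Sum>T\<in>Pow {..<k}. frag_cmul ((-1) ^ card (insert k T)) (frag_of (orthant_simplex k (insert k T))))
    = - chain_map k (flip {k}) (upper_chain k)"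
    unfolding upper_chain_def
    by (simp add: chain_map_sum sum_negf[symmetric] o_def simplex_map_flip_orthant **
        del: Pow_iff cong: sum.cong)
  finally show ?thesis by simp
qed

lemma singular_chain_orthants:
  "singular_chain k (nsphere k) (\<Sum>T\<in>A. frag_cmul (a T) (frag_of (orthant_simplex k T)))"
  by (intro singular_chain_sum singular_chain_cmul) (simp add: singular_chain_of singular_orthant_simplex)

lemma singular_chain_sphere: "singular_chain k (nsphere k) (sphere_chain k)"
  unfolding sphere_chain_def by (rule singular_chain_orthants)

lemma singular_chain_upper: "singular_chain k (subtopology (nsphere k) {x. x k \<ge> 0}) (upper_chain k)"
  unfolding upper_chain_def
proof (intro singular_chain_sum singular_chain_cmul)
  fix T assume T: "T \<in> Pow {..<k}"
  then have "orthant_simplex k T x k \<ge> 0" if "x \<in> standard_simplex k" for x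
    using that standard_simplex_sum_squares[OF that]
    by (auto simp: orthant_simplex_def flip_def standard_simplex_def)
  then show "singular_chain k (subtopology (nsphere k) {x. 0 \<le> x k}) (frag_of (orthant_simplex k T))"
    unfolding singular_chain_of singular_simplex_subtopology
    using singular_orthant_simplex by auto
qed

lemma singular_face_orthant_last:
  assumes "T \<subseteq> {..<Suc k}"
  shows "singular_face (Suc k) (Suc k) (orthant_simplex (Suc k) T) = orthant_simplex k T"
proof -
  have "orthant_simplex (Suc k) T (simplical_face (Suc k) x) = orthant_simplex k T x"
    if x: "x \<in> standard_simplex k" for x
  proof -
    have "(\<Sum>j\<le>Suc k. (simplical_face (Suc k) x j)\<^sup>2) = (\<Sum>j\<le>k. (x j)\<^sup>2)"
      by (simp add: simplical_face_def)
    moreover have "simplical_face (Suc k) x = x"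
      using x by (auto simp: simplical_face_def standard_simplex_def)
    moreover have "x \<in> standard_simplex (Suc k)"
      using x standard_simplex_mono[of k "Suc k"] by auto
    ultimately show ?thesis
      using x by (simp add: orthant_simplex_def)
  qed
  then show ?thesis
    unfolding singular_face_def by (auto simp: orthant_simplex_def)
qed

text \<open>Coordinate \<open>j\<close> vanishes on face \<open>j\<close>, so reversing its sign has
  no effect there.\<close>

lemma singular_face_orthant_insert:
  assumes "j \<le> Suc k"
  shows "singular_face (Suc k) j (orthant_simplex (Suc k) (insert j T)) =
    singular_face (Suc k) j (orthant_simplex (Suc k) T)"
  unfolding singular_face_def
  using simplical_face_in_standard_simplex[of "Suc k" j] assms
  by (intro restrict_ext) (auto simp: orthant_simplex_def flip_def simplical_face_def)

lemma alternating_sum_Pow: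
  fixes F :: "'b set \<Rightarrow> 'a \<Rightarrow>\<^sub>0 int"
  assumes "finite A" "j \<in> A" "\<And>T. F (insert j T) = F T"
  shows "(\<Sum>T\<in>Pow A. frag_cmul ((-1) ^ card T) (F T)) = 0"
proof -
  define B where "B = A - {j}"
  have A: "A = insert j B" "j \<notin> B" "finite B"
    using assms by (auto simp: B_def)
  have inj: "inj_on (insert j) (Pow B)"
    by (rule inj_onI) (metis A(2) PowD insert_ident subsetD)
  have "card (insert j T) = Suc (card T)" if "T \<in> Pow B" for T
    using that A finite_subset by (subst card_insert_disjoint) auto
  moreover have "Pow B \<inter> insert j ` Pow B = {}" using A by auto
  ultimately show ?thesis
    unfolding A(1) Pow_insert
    by (subst sum.union_disjoint) (use A inj in \<open>auto simp: sum.reindex assms(3) simp flip: sum.distrib frag_cmul_distrib\<close>)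
qed

text \<open>For \<open>j \<le> k\<close>, face \<open>j\<close> is shared by two orthants of
  opposite sign and cancels by \<open>alternating_sum_Pow\<close>. Only face \<open>Suc k\<close>
  survives; it lies on the equator, where these faces are the orthants of S^k with unchanged
  signs.\<close>

lemma chain_boundary_upper:
  "chain_boundary (Suc k) (upper_chain (Suc k)) = frag_cmul ((-1) ^ Suc k) (sphere_chain k)"
proof -
  let ?F = "\<lambda>j T. frag_of (singular_face (Suc k) j (orthant_simplex (Suc k) T))"
  have "chain_boundary (Suc k) (upper_chain (Suc k)) =
     (\<Sum>T\<in>Pow {..<Suc k}. \<Sum>j\<le>Suc k. frag_cmul ((-1) ^ j) (frag_cmul ((-1) ^ card T) (?F j T)))"
    unfolding upper_chain_def chain_boundary_sum o_def chain_boundary_cmul chain_boundary_of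
    by (simp add: frag_cmul_sum mult.commute del: sum.atMost_Suc)
  also have "\<dots> = (\<Sum>j\<le>Suc k. frag_cmul ((-1) ^ j) (\<Sum>T\<in>Pow {..<Suc k}. frag_cmul ((-1) ^ card T) (?F j T)))"
    by (subst sum.swap) (simp add: frag_cmul_sum del: sum.atMost_Suc)
  also have "\<dots> = (\<Sum>j\<le>Suc k. if j = Suc k then
     frag_cmul ((-1) ^ Suc k) (\<Sum>T\<in>Pow {..<Suc k}. frag_cmul ((-1) ^ card T) (?F (Suc k) T)) else 0)"
  proof (rule sum.cong[OF refl])
    fix j assume "j \<in> {..Suc k}"
    then consider "j = Suc k" | "j \<le> k" by fastforce
    then show "frag_cmul ((-1) ^ j) (\<Sum>T\<in>Pow {..<Suc k}. frag_cmul ((-1) ^ card T) (?F j T)) =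
      (if j = Suc k then frag_cmul ((-1) ^ Suc k)
        (\<Sum>T\<in>Pow {..<Suc k}. frag_cmul ((-1) ^ card T) (?F (Suc k) T)) else 0)"
    proof cases
      case 2
      have "(\<Sum>T\<in>Pow {..<Suc k}. frag_cmul ((-1) ^ card T) (?F j T)) = 0"
        by (rule alternating_sum_Pow[of _ j]) (use 2 in \<open>auto simp: singular_face_orthant_insert\<close>)
      with 2 show ?thesis by simp
    qed simp
  qed
  also have "\<dots> = frag_cmul ((-1) ^ Suc k) (\<Sum>T\<in>Pow {..<Suc k}. frag_cmul ((-1) ^ card T) (?F (Suc k) T))"
    by simp
  also have "(\<Sum>T\<in>Pow {..<Suc k}. frag_cmul ((-1) ^ card T) (?F (Suc k) T)) = sphere_chain k"
    unfolding sphere_chain_def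
    by (rule sum.cong) (auto simp: singular_face_orthant_last lessThan_Suc_atMost)
  finally show ?thesis .
qed

lemma chain_map_flip_disjoint:
  assumes "singular_chain p (nsphere k) c" "T \<inter> {..k} = {}"
  shows "chain_map p (flip T) c = c"
proof (rule chain_map_id_gen[OF assms(1)])
  fix x assume "x \<in> topspace (nsphere k)"
  then show "flip T x = x"
    using assms(2) by (intro ext) (force simp: topspace_nsphere flip_def disjoint_iff)
qed

text \<open>Both hemispheres have the same boundary, because the reflection fixes the equator
  pointwise.\<close>

lemma chain_boundary_sphere: "chain_boundary k (sphere_chain k) = 0"
proof (cases k)
  case 0
  then show ?thesis by (simp add: chain_boundary_def)
next
  case (Suc l)
  have "singular_chain k (nsphere k) (upper_chain k)"
    unfolding upper_chain_def by (rule singular_chain_orthants)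
  then show ?thesis
    using chain_map_flip_disjoint[OF singular_chain_sphere, of "{k}" l]
    by (simp add: Suc sphere_chain_eq[of "Suc l"] chain_boundary_diff chain_boundary_chain_map chain_boundary_upper)
qed

lemma chain_map_flip_flip:
  "chain_map k (flip S) (chain_map k (flip T) c) = chain_map k (flip (sym_diff S T)) c"
proof -
  have "flip S \<circ> flip T = flip (sym_diff S T)" by (rule ext) (simp add: flip_flip)
  then show ?thesis by (metis chain_map_compose comp_apply)
qed

lemma chain_map_flip_last_sphere: "chain_map k (flip {k}) (sphere_chain k) = - sphere_chain k"
proof -
  have "singular_chain k (nsphere k) (upper_chain k)"
    unfolding upper_chain_def by (rule singular_chain_orthants)
  then have "chain_map k (flip {k}) (chain_map k (flip {k}) (upper_chain k)) = upper_chain k"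
    by (metis Diff_cancel Un_absorb chain_map_flip_flip chain_map_ident flip_empty)
  then show ?thesis
    by (simp add: sphere_chain_eq chain_map_diff)
qed

text \<open>This is an equality of chains, not only of classes: in the sum of the chain and its
  mirror image the summand \<open>?F T\<close> does not change when \<open>j\<close> is inserted, so
  the alternating sum is 0.\<close>

lemma chain_map_flip_upper:
  assumes "j < k"
  shows "chain_map k (flip {j}) (upper_chain k) = - upper_chain k"
proof -
  let ?F = "\<lambda>T. frag_of (orthant_simplex k T) + frag_of (orthant_simplex k (sym_diff {j} T))"
  have "upper_chain k + chain_map k (flip {j}) (upper_chain k) =
    (\<Sum>T\<in>Pow {..<k}. frag_cmul ((-1) ^ card T) (?F T))"
    unfolding upper_chain_def
    by (simp add: chain_map_sum o_def simplex_map_flip_orthant frag_cmul_distrib2 sum.distrib)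
  also have "\<dots> = 0"
  proof (rule alternating_sum_Pow)
    fix T
    show "?F (insert j T) = ?F T"
    proof (cases "j \<in> T")
      case False
      then have "sym_diff {j} (insert j T) = T" "sym_diff {j} T = insert j T" by auto
      then show ?thesis by (simp add: add.commute)
    qed (simp add: insert_absorb)
  qed (use assms in auto)
  finally show ?thesis
    by (metis add.commute eq_neg_iff_add_eq_0)
qed

lemma chain_map_flip_lessThan_upper:
  "m \<le> k \<Longrightarrow> chain_map k (flip {..<m}) (upper_chain k) = frag_cmul ((-1) ^ m) (upper_chain k)"
proof (induction m)
  case 0
  have "singular_chain k (nsphere k) (upper_chain k)"
    unfolding upper_chain_def by (rule singular_chain_orthants)
  then show ?case
    by (metis chain_map_ident flip_empty frag_cmul_one lessThan_0 power_0)
next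
  case (Suc m)
  have eq: "flip {..<Suc m} = flip {m} \<circ> flip {..<m}"
    by (rule ext) (auto simp: flip_def)
  show ?case
    unfolding eq chain_map_comp using Suc by (simp add: chain_map_flip_upper flip: frag_cmul_minus_one)
qed

text \<open>The first \<open>k\<close> coordinates contribute one sign each, and the last one
  exchanges the hemispheres. Hence a map invariant under the antipode sends the two hemisphere
  chains to the same chain up to sign.\<close>

lemma chain_map_antipodal_upper:
  "chain_map k (flip {..k}) (upper_chain k) = frag_cmul ((-1) ^ k) (chain_map k (flip {k}) (upper_chain k))"
proof -
  have eq: "flip {..k} = flip {k} \<circ> flip {..<k}"
    by (rule ext) (auto simp: flip_def)
  show ?thesis
    unfolding eq chain_map_comp by (simp add: chain_map_flip_lessThan_upper)
qed

subsection \<open>Divisibility by two in the homology of spheres\<close>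

text \<open>Divisibility of the class by 2 in integral homology; it stands in for vanishing modulo
  2.\<close>

definition even_class :: "nat \<Rightarrow> 'a topology \<Rightarrow> 'a chain \<Rightarrow> bool" where
  "even_class p X c \<longleftrightarrow> (\<exists>x G. singular_relcycle p X {} x \<and> singular_chain (Suc p) X G \<and>
     c = x + x + chain_boundary (Suc p) G)"

lemma even_class_minus:
  assumes "even_class p X c"
  shows "even_class p X (- c)"
proof -
  obtain x G where "singular_relcycle p X {} x" "singular_chain (Suc p) X G"
    and c: "c = x + x + chain_boundary (Suc p) G"
    using assms unfolding even_class_def by blast
  then have "singular_relcycle p X {} (- x)" "singular_chain (Suc p) X (- G)"
    by (simp_all add: singular_relcycle_minus singular_chain_minus)
  moreover have "- c = - x + - x + chain_boundary (Suc p) (- G)"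
    by (simp add: c chain_boundary_minus)
  ultimately show ?thesis
    unfolding even_class_def by blast
qed

lemma even_class_add_boundary:
  assumes "even_class p X c" "singular_relboundary p X {} d"
  shows "even_class p X (c + d)"
proof -
  obtain x G where x: "singular_relcycle p X {} x" and G: "singular_chain (Suc p) X G"
    and c: "c = x + x + chain_boundary (Suc p) G"
    using assms unfolding even_class_def by blast
  obtain v where v: "singular_chain (Suc p) X v" "chain_boundary (Suc p) v = d"
    using assms(2) unfolding singular_boundary by blast
  have "c + d = x + x + chain_boundary (Suc p) (G + v)"
    by (simp add: c v chain_boundary_add)
  then show ?thesis
    unfolding even_class_def using x singular_chain_add[OF G v(1)] by blast
qed

lemma subtopology_upper_hemisphere_equator:
  "subtopology (subtopology (nsphere (Suc k)) {x. x (Suc k) \<ge> 0}) {x. x (Suc k) = 0} = nsphere k"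
proof -
  have "{x. 0 \<le> x (Suc k)} \<inter> {x. x (Suc k) = 0} = {x. x (Suc k) = (0::real)}"
    by auto
  then show ?thesis
    by (simp add: subtopology_nsphere_equator subtopology_subtopology)
qed

text \<open>By excision, \<open>H\<^sub>n(S\<^sup>n) \<rightarrow> H\<^sub>n(S\<^sup>n, D\<^sub>-) \<cong> H\<^sub>n(D\<^sub>+, S\<^sup>n\<^sup>-\<^sup>1) \<rightarrow> H\<^sub>n\<^sub>-\<^sub>1(S\<^sup>n\<^sup>-\<^sup>1)\<close> sends
  the class of \<open>A + B\<close> to that of the boundary of \<open>A\<close>.\<close>

lemma even_class_boundary_upper:
  assumes A: "singular_chain (Suc k) (subtopology (nsphere (Suc k)) {x. x (Suc k) \<ge> 0}) A"
    and B: "singular_chain (Suc k) (subtopology (nsphere (Suc k)) {x. x (Suc k) \<le> 0}) B"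
    and even: "even_class (Suc k) (nsphere (Suc k)) (A + B)"
  shows "even_class k (nsphere k) (chain_boundary (Suc k) A)"
proof -
  let ?X = "nsphere (Suc k)" and ?U = "{x::nat\<Rightarrow>real. x (Suc k) \<ge> 0}" and ?L = "{x::nat\<Rightarrow>real. x (Suc k) \<le> 0}"
  let ?E = "{x::nat\<Rightarrow>real. x (Suc k) = 0}" and ?p = "Suc k"
  let ?D = "subtopology ?X ?U"
  let ?h = "hom_induced (int ?p) ?D ?E ?X ?L id"
  have iso: "?h \<in> iso (relative_homology_group (int ?p) ?D ?E) (relative_homology_group (int ?p) ?X ?L)"
    using iso_relative_homology_group_upper_hemisphere .
  have h: "?h (homologous_rel_set ?p ?D ?E c) = homologous_rel_set ?p ?X ?L c"
    if "singular_relcycle ?p ?D ?E c" for c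
  proof -
    have "?h (homologous_rel_set ?p ?D ?E c) = homologous_rel_set ?p ?X ?L (chain_map ?p id c)"
      by (rule hom_induced_chain_map) (use that in \<open>auto simp: continuous_map_from_subtopology\<close>)
    also have "chain_map ?p id c = c"
      by (rule chain_map_ident) (use that in \<open>auto simp: singular_relcycle\<close>)
    finally show ?thesis .
  qed
  obtain x G where x: "singular_relcycle ?p ?X {} x" and G: "singular_chain (Suc ?p) ?X G"
    and eq: "A + B = x + x + chain_boundary (Suc ?p) G"
    using even unfolding even_class_def by blast
  have xL: "singular_relcycle ?p ?X ?L x"
    unfolding singular_relcycle using x[unfolded singular_cycle] by simp
  \<comment> \<open>Surjectivity of \<open>?h\<close> yields a relative cycle \<open>a\<close> of
    the upper hemisphere that represents the relative class of \<open>x\<close>.\<close>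
  then have "homologous_rel_set ?p ?X ?L x \<in> ?h ` carrier (relative_homology_group (int ?p) ?D ?E)"
    using iso unfolding iso_def bij_betw_def carrier_relative_homology_group by blast
  then obtain a where a: "singular_relcycle ?p ?D ?E a"
    and ax: "homologous_rel_set ?p ?X ?L x = homologous_rel_set ?p ?X ?L a"
    using h unfolding carrier_relative_homology_group by auto
  have xa: "singular_relboundary ?p ?X ?L (x - a)"
    using ax unfolding homologous_rel_set_eq by (simp add: homologous_rel_def)
  have "chain_boundary ?p (A + B) = 0"
    unfolding eq chain_boundary_add using x chain_boundary_boundary_alt[OF G]
    by (simp add: singular_cycle)
  then have bdA: "chain_boundary ?p A = - chain_boundary ?p B"
    by (simp add: chain_boundary_add eq_neg_iff_add_eq_0)
  \<comment> \<open>The boundary of \<open>A\<close> is also minus that of \<open>B\<close>, so it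
    lies in both hemispheres and hence on the equator.\<close>
  have "singular_chain k (subtopology ?X ?L) (chain_boundary ?p A)"
    unfolding bdA singular_chain_minus by (rule singular_chain_boundary_alt[OF B])
  moreover have "singular_chain k (subtopology ?X ?U) (chain_boundary ?p A)"
    by (rule singular_chain_boundary_alt[OF A])
  ultimately have "singular_chain k (subtopology ?D ?E) (chain_boundary ?p A)"
    unfolding singular_chain_subtopology by fastforce
  then have "singular_relcycle ?p ?D ?E A"
    using A by (simp add: singular_relcycle)
  then have Aa: "singular_relcycle ?p ?D ?E (A - (a + a))"
    using a by (intro singular_relcycle_diff singular_relcycle_add)
  \<comment> \<open>The right-hand side vanishes up to boundaries and chains of the lower
    hemisphere. Injectivity of \<open>?h\<close> then makes \<open>A - (a + a)\<close> a boundary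
    within the upper hemisphere, relative to the equator.\<close>
  have "A - (a + a) = ((x - a) + (x - a)) + (chain_boundary (Suc ?p) G - B)"
    using eq by (simp add: algebra_simps)
  moreover have "singular_relboundary ?p ?X ?L (chain_boundary (Suc ?p) G)"
    unfolding singular_relboundary using G by (metis add.right_neutral singular_chain_0)
  ultimately have "singular_relboundary ?p ?X ?L (A - (a + a))"
    using xa singular_chain_imp_relboundary[OF B]
    by (metis singular_relboundary_add singular_relboundary_diff)
  then have "?h (homologous_rel_set ?p ?D ?E (A - (a + a))) = ?h (homologous_rel_set ?p ?D ?E 0)"
    unfolding h[OF Aa] h[OF singular_relcycle_0] homologous_rel_set_eq by (simp add: homologous_rel_def)
  then have "homologous_rel_set ?p ?D ?E (A - (a + a)) = homologous_rel_set ?p ?D ?E 0"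
    using iso Aa unfolding iso_def bij_betw_def carrier_relative_homology_group
    by (metis (mono_tags, lifting) imageI inj_onD mem_Collect_eq singular_relcycle_0)
  then have "singular_relboundary ?p ?D ?E (A - (a + a))"
    unfolding homologous_rel_set_eq by (simp add: homologous_rel_def)
  then obtain d e where d: "singular_chain (Suc ?p) ?D d" and e: "singular_chain ?p (subtopology ?D ?E) e"
    and de: "chain_boundary (Suc ?p) d + e = A - (a + a)"
    unfolding singular_relboundary by blast
  have "chain_boundary ?p (A - (a + a)) = chain_boundary ?p e"
    unfolding de[symmetric] chain_boundary_add using chain_boundary_boundary_alt[OF d] by simp
  then have "chain_boundary ?p A = chain_boundary ?p a + chain_boundary ?p a + chain_boundary ?p e"
    by (simp add: chain_boundary_diff chain_boundary_add algebra_simps)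
  moreover have "singular_relcycle k (nsphere k) {} (chain_boundary ?p a)"
    using a chain_boundary_boundary_alt[of k ?D a]
    by (auto simp: singular_relcycle singular_chain_empty subtopology_upper_hemisphere_equator)
  ultimately show ?thesis
    unfolding even_class_def using e by (auto simp: subtopology_upper_hemisphere_equator)
qed

section \<open>The fundamental class of a sphere is not divisible by two\<close>

lemma singular_chain_flip_upper:
  "singular_chain k (subtopology (nsphere k) {x. x k \<le> 0}) (chain_map k (flip {k}) (upper_chain k))"
proof (rule singular_chain_chain_map[OF singular_chain_upper])
  show "continuous_map (subtopology (nsphere k) {x. 0 \<le> x k}) (subtopology (nsphere k) {x. x k \<le> 0}) (flip {k})"
    using continuous_map_flip[of k "{k}"]
    by (auto simp: continuous_map_in_subtopology continuous_map_from_subtopology flip_def)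
qed

text \<open>S^0 consists of two points, so by connectedness each singular 1-simplex is constant and
  its two faces agree.\<close>

lemma chain_boundary_1_nsphere_0:
  assumes "singular_chain (Suc 0) (nsphere 0) G"
  shows "chain_boundary (Suc 0) G = 0"
  using assms unfolding singular_chain_def
proof (induction G rule: frag_induction)
  case (one f)
  then have f: "continuous_map (simplex_space 1) (nsphere 0) f"
    by (auto simp: singular_simplex_def)
  have g: "continuous_map (simplex_space 1) euclideanreal (\<lambda>x. f x 0)"
    using continuous_map_compose[OF f continuous_map_nsphere_projection[of 0 0]] by (simp add: o_def)
  have "connectedin (simplex_space 1) (standard_simplex 1)"
    using connectedin_standard_simplex[of 1] by (simp add: connectedin_subtopology)
  from connectedin_continuous_map_image[OF g this]
  have conn: "connected ((\<lambda>x. f x 0) ` standard_simplex 1)" by simp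
  have sq: "(f x 0)\<^sup>2 = 1 \<and> (\<forall>i>0. f x i = 0)" if "x \<in> standard_simplex 1" for x
    using f that by (force simp: continuous_map_def topspace_nsphere Pi_iff)
  have const: "f x = f y" if x: "x \<in> standard_simplex 1" and y: "y \<in> standard_simplex 1" for x y
  proof -
    have "f x 0 = f y 0"
    proof (rule ccontr)
      assume ne: "f x 0 \<noteq> f y 0"
      have "0 \<in> (\<lambda>x. f x 0) ` standard_simplex 1"
        using connectedD_interval[OF conn, of "min (f x 0) (f y 0)" "max (f x 0) (f y 0)" 0]
          sq[OF x] sq[OF y] ne imageI[OF x, of "\<lambda>x. f x 0"] imageI[OF y, of "\<lambda>x. f x 0"]
        by (auto simp: power2_eq_1_iff min_def max_def split: if_splits)
      then show False using sq by fastforce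
    qed
    then show ?thesis using sq[OF x] sq[OF y] by (metis ext gr0I)
  qed
  have "singular_face (Suc 0) 0 f = singular_face (Suc 0) (Suc 0) f"
    unfolding singular_face_def using simplical_face_in_standard_simplex[of "Suc 0"]
    by (intro restrict_ext) (auto intro!: const)
  then show ?case
    by (simp add: chain_boundary_of)
qed (auto simp: chain_boundary_diff)

text \<open>By induction on the dimension: cutting along the equator with
  \<open>even_class_boundary_upper\<close> passes evenness from S^(k+1) to S^k, up to sign. On S^0
  boundaries of 1-chains are 0, and the coefficient 1 of one of the two simplices is odd.\<close>

lemma sphere_chain_not_even: "\<not> even_class k (nsphere k) (sphere_chain k)"
proof (induction k)
  case 0
  show ?case
  proof
    assume "even_class 0 (nsphere 0) (sphere_chain 0)"
    then obtain x G where G: "singular_chain (Suc 0) (nsphere 0) G"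
      and eq: "sphere_chain 0 = x + x + chain_boundary (Suc 0) G"
      unfolding even_class_def by blast
    let ?e = "\<lambda>j. if j = 0 then 1 else 0 :: real"
    have e: "?e \<in> standard_simplex 0" by simp
    have "orthant_simplex 0 {} ?e 0 \<noteq> orthant_simplex 0 {0} ?e 0"
      unfolding orthant_simplex_def restrict_apply' [OF e] by (simp add: flip_def)
    then have "orthant_simplex 0 {} \<noteq> orthant_simplex 0 {0}"
      by metis
    moreover have "sphere_chain 0 = frag_of (orthant_simplex 0 {}) - frag_of (orthant_simplex 0 {0})"
    proof -
      have "Pow {..0::nat} = {{}, {0}}" by auto
      then show ?thesis by (simp add: sphere_chain_def)
    qed
    ultimately have "Poly_Mapping.lookup (sphere_chain 0) (orthant_simplex 0 {}) = 1"
      by (simp add: lookup_minus lookup_frag_of)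
    moreover have "sphere_chain 0 = x + x"
      using eq chain_boundary_1_nsphere_0[OF G] by simp
    ultimately show False
      by (simp add: lookup_add) presburger
  qed
next
  case (Suc k)
  show ?case
  proof
    assume "even_class (Suc k) (nsphere (Suc k)) (sphere_chain (Suc k))"
    then have "even_class (Suc k) (nsphere (Suc k))
        (upper_chain (Suc k) + - chain_map (Suc k) (flip {Suc k}) (upper_chain (Suc k)))"
      by (simp add: sphere_chain_eq)
    then have "even_class k (nsphere k) (chain_boundary (Suc k) (upper_chain (Suc k)))"
      by (rule even_class_boundary_upper[OF singular_chain_upper, rotated])
        (simp add: singular_chain_minus singular_chain_flip_upper)
    then have "even_class k (nsphere k) (sphere_chain k)"
      using even_class_minus[of k "nsphere k" "- sphere_chain k"]
      by (cases "even k") (auto simp: chain_boundary_upper)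
    then show False
      using Suc by blast
  qed
qed

text \<open>The rotation by the angle \<open>pi * fst w\<close> in the plane of the last two
  coordinates: the inclusion of S^k for \<open>u = 0\<close>, the reflection \<open>flip {k}\<close>
  for \<open>u = 1\<close>. Each hemisphere of S^k sweeps out the hemisphere of S^(k+1) on the same
  side.\<close>

definition wrap :: "nat \<Rightarrow> real \<times> (nat \<Rightarrow> real) \<Rightarrow> nat \<Rightarrow> real" where
  "wrap k w = (\<lambda>i. if i = k then snd w k * cos (pi * fst w)
     else if i = Suc k then snd w k * sin (pi * fst w) else snd w i)"

lemma wrap_in_nsphere:
  assumes "y \<in> topspace (nsphere k)"
  shows "wrap k (u, y) \<in> topspace (nsphere (Suc k))"
proof -
  have *: "(\<Sum>i\<le>k. g i) = (\<Sum>i<k. g i) + g k" for g :: "nat \<Rightarrow> real"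
    by (simp add: lessThan_Suc_atMost[symmetric])
  have "(\<Sum>i\<le>Suc k. (wrap k (u, y) i)\<^sup>2) = (\<Sum>i<k. (y i)\<^sup>2) + ((y k * cos (pi * u))\<^sup>2 + (y k * sin (pi * u))\<^sup>2)"
    by (simp add: * wrap_def)
  also have "(y k * cos (pi * u))\<^sup>2 + (y k * sin (pi * u))\<^sup>2 = (y k)\<^sup>2"
    by (simp add: power_mult_distrib flip: distrib_left)
  finally show ?thesis
    using assms by (simp add: topspace_nsphere * wrap_def)
qed

lemma continuous_map_wrap:
  "continuous_map (prod_topology unit_interval (nsphere k)) (nsphere (Suc k)) (wrap k)"
proof (rule continuous_map_into_nsphere)
  fix i
  have 1: "continuous_map (prod_topology unit_interval (nsphere k)) euclideanreal fst"
    using continuous_map_fst continuous_map_in_subtopology by blast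
  have 2: "continuous_map (prod_topology unit_interval (nsphere k)) euclideanreal (\<lambda>z. snd z j)" for j
    by (rule continuous_map_compose[OF continuous_map_snd continuous_map_nsphere_projection, unfolded o_def])
  have cs: "continuous_map euclideanreal euclideanreal (\<lambda>u. cos (pi * u))"
    "continuous_map euclideanreal euclideanreal (\<lambda>u. sin (pi * u))"
    by (auto intro!: continuous_intros)
  show "continuous_map (prod_topology unit_interval (nsphere k)) euclideanreal (\<lambda>w. wrap k w i)"
    unfolding wrap_def
    using continuous_map_compose[OF 1 cs(1)] continuous_map_compose[OF 1 cs(2)]
    by (auto simp: o_def intro!: continuous_map_real_mult 2)
qed (auto intro: wrap_in_nsphere)

lemma continuous_map_wrap_hemisphere:
  assumes "\<And>u y. u \<in> {0..1} \<Longrightarrow> y \<in> topspace (nsphere k) \<Longrightarrow> y \<in> S \<Longrightarrow> wrap k (u, y) \<in> T"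
  shows "continuous_map (prod_topology unit_interval (subtopology (nsphere k) S))
    (subtopology (nsphere (Suc k)) T) (wrap k)"
proof -
  have "prod_topology unit_interval (subtopology (nsphere k) S)
     = subtopology (prod_topology unit_interval (nsphere k)) (UNIV \<times> S)"
    by (metis subtopology_Times subtopology_UNIV)
  then show ?thesis
    using assms continuous_map_wrap[of k]
    by (auto simp: continuous_map_in_subtopology continuous_map_from_subtopology)
qed

section \<open>The homological obstruction\<close>

lemma frag_double_eq_0: "x + x = 0 \<Longrightarrow> x = 0" for x :: "'a \<Rightarrow>\<^sub>0 int"
proof (rule poly_mapping_eqI)
  fix s assume "x + x = 0"
  then have "Poly_Mapping.lookup (x + x) s = 0" by simp
  then show "Poly_Mapping.lookup x s = Poly_Mapping.lookup 0 s"
    by (simp add: lookup_add)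
qed

text \<open>\<open>glue\<close> lets \<open>H\<close> descend to the closed manifold, and
  \<open>anti\<close> makes its initial map even. The prism over \<open>c\<close> then shows that
  the image of \<open>c\<close> under \<open>wrap\<close> is even up to a boundary. That image has
  boundary \<open>- z - z\<close>, so adding \<open>e\<close> twice closes it; cutting the resulting
  cycle along the equator leaves \<open>sphere_chain k\<close> up to a boundary.\<close>

lemma no_symmetric_homotopy:
  assumes k: "k \<ge> 1"
    and H: "continuous_map (prod_topology unit_interval (prod_topology unit_interval (nsphere k)))
              (nsphere (Suc k)) H"
    and glue: "\<And>t y. t \<in> {0..1} \<Longrightarrow> y \<in> topspace (nsphere k) \<Longrightarrow> H (t, (1, y)) = H (t, (0, flip {k} y))"
    and anti: "\<And>u y. u \<in> {0..1} \<Longrightarrow> y \<in> topspace (nsphere k) \<Longrightarrow> H (0, (u, flip {..k} y)) = H (0, (u, y))"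
    and wrap: "\<And>u y. u \<in> {0..1} \<Longrightarrow> y \<in> topspace (nsphere k) \<Longrightarrow> H (1, (u, y)) = wrap k (u, y)"
  shows False
proof -
  let ?S = "nsphere k" and ?Y = "nsphere (Suc k)"
  let ?W = "prod_topology unit_interval ?S"
  define z u r where "z = sphere_chain k" and "u = upper_chain k" and "r = flip {k}"
  define c where "c = prism k z"
  define F where "F = H \<circ> Pair 0"
  define E where "E = chain_map (Suc k) (H \<circ> map_prod id (Pair 0)) (prism k z)"
  define G where "G = chain_map (Suc (Suc k)) H (prism (Suc k) c)"
  define e where "e = frag_cmul ((-1) ^ Suc k) (upper_chain (Suc k))"
  have z: "singular_chain k ?S z" and bz: "chain_boundary k z = 0"
    by (simp_all add: z_def singular_chain_sphere chain_boundary_sphere)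
  have zu: "z = u - chain_map k r u"
    by (simp add: z_def u_def r_def sphere_chain_eq)
  have rz: "chain_map k r z = - z"
    by (simp add: z_def r_def chain_map_flip_last_sphere)
  have uU: "singular_chain k (subtopology ?S {x. x k \<ge> 0}) u"
    by (simp add: u_def singular_chain_upper)
  then have u: "singular_chain k ?S u"
    by (simp add: singular_chain_subtopology)
  have ruL: "singular_chain k (subtopology ?S {x. x k \<le> 0}) (chain_map k r u)"
    by (simp add: u_def r_def singular_chain_flip_upper)
  have c: "singular_chain (Suc k) ?W c"
    unfolding c_def by (rule singular_chain_prism[OF z])
  have bc: "chain_boundary (Suc k) c = chain_map k (Pair 1) z - chain_map k (Pair 0) z"
    unfolding c_def by (simp add: chain_boundary_prism[OF z] bz)
  have G: "singular_chain (Suc (Suc k)) ?Y G"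
    unfolding G_def by (rule singular_chain_chain_map[OF singular_chain_prism[OF c] H])
  \<comment> \<open>Over the end \<open>u = 1\<close> the homotopy is that over \<open>u = 0\<close>
    composed with \<open>r\<close>, and \<open>r\<close> reverses \<open>z\<close>. The two ends
    therefore add up to twice \<open>E\<close> instead of cancelling.\<close>
  have E1: "chain_map (Suc k) (H \<circ> map_prod id (Pair 1)) (prism k z) = - E"
  proof -
    have "chain_map (Suc k) (H \<circ> map_prod id (Pair 1)) (prism k z)
        = chain_map (Suc k) ((H \<circ> map_prod id (Pair 0)) \<circ> map_prod id r) (prism k z)"
      by (rule chain_map_eq[OF singular_chain_prism[OF z]]) (auto simp: glue r_def)
    also have "\<dots> = - E"
      unfolding chain_map_comp[of _ "H \<circ> map_prod id (Pair 0)"] chain_map_prism rz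
      by (simp only: prism_minus chain_map_minus E_def)
    finally show ?thesis .
  qed
  have "chain_map (Suc k) H (prism k (chain_boundary (Suc k) c)) = - E - E"
    unfolding bc prism_diff chain_map_diff chain_map_prism[symmetric]
    unfolding chain_map_comp[symmetric] E1 unfolding E_def ..
  moreover have "chain_map (Suc k) (H \<circ> Pair 1) c = chain_map (Suc k) (wrap k) c"
    by (rule chain_map_eq[OF c]) (auto simp: wrap)
  ultimately have bG: "chain_boundary (Suc (Suc k)) G =
      chain_map (Suc k) (wrap k) c - chain_map (Suc k) F c + E + E"
    unfolding G_def using chain_boundary_chain_map[OF singular_chain_prism[OF c], of H]
    by (simp add: chain_boundary_prism[OF c] chain_map_diff F_def flip: chain_map_comp)
  have contF: "continuous_map ?W ?Y F"
    unfolding F_def by (rule continuous_map_compose[OF continuous_map_Pair_right H]) simp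
  \<comment> \<open>By \<open>anti\<close>, the images of \<open>prism k u\<close> and of its
    reflection agree up to the sign \<open>(-1) ^ k\<close>. Their difference is thus 0 for even
    \<open>k\<close> and twice \<open>?P\<close> for odd \<open>k\<close>.\<close>
  have "\<exists>g. singular_chain (Suc k) ?Y g \<and> chain_map (Suc k) F c = g + g"
  proof -
    let ?P = "chain_map (Suc k) F (prism k u)"
    have "chain_map (Suc k) F (prism k (chain_map k (flip {..k}) u)) = ?P"
      unfolding chain_map_prism[symmetric] chain_map_comp[symmetric]
      by (rule chain_map_eq[OF singular_chain_prism[OF u]]) (auto simp: anti F_def)
    then have P: "frag_cmul ((-1) ^ k) (chain_map (Suc k) F (prism k (chain_map k r u))) = ?P"
      by (simp add: u_def r_def chain_map_antipodal_upper prism_cmul)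
    have Fc: "chain_map (Suc k) F c = ?P - chain_map (Suc k) F (prism k (chain_map k r u))"
      by (simp add: c_def zu prism_diff chain_map_diff)
    show ?thesis
    proof (cases "even k")
      case True
      then show ?thesis using P Fc by (intro exI[of _ 0]) simp
    next
      case False
      then show ?thesis using P Fc singular_chain_chain_map[OF singular_chain_prism[OF u] contF]
        by (intro exI[of _ ?P]) (simp add: minus_equation_iff[of _ ?P])
    qed
  qed
  then obtain g where g: "singular_chain (Suc k) ?Y g" "chain_map (Suc k) F c = g + g"
    by blast
  have be: "chain_boundary (Suc k) e = z"
    by (simp add: e_def z_def chain_boundary_cmul chain_boundary_upper flip: power_mult_distrib)
  have eU: "singular_chain (Suc k) (subtopology ?Y {x. x (Suc k) \<ge> 0}) e"
    unfolding e_def by (intro singular_chain_cmul singular_chain_upper)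
  then have e: "singular_chain (Suc k) ?Y e"
    by (simp add: singular_chain_subtopology)
  have w0: "wrap k (0, y) = y" if "y \<in> topspace ?S" for y
    using that by (auto simp: wrap_def topspace_nsphere)
  have w1: "wrap k (1, y) = r y" if "y \<in> topspace ?S" for y
    using that by (auto simp: wrap_def topspace_nsphere r_def flip_def)
  have wP0: "chain_map k (wrap k) (chain_map k (Pair 0) v) = v"
    and wP1: "chain_map k (wrap k) (chain_map k (Pair 1) v) = chain_map k r v"
    if "singular_chain k ?S v" for v
    unfolding chain_map_comp[symmetric] using that
    by (auto intro!: chain_map_id_gen chain_map_eq[OF that] simp: w0 w1)
  \<comment> \<open>Half of the even terms of \<open>bG\<close> and of the closing term
    \<open>e + e\<close>.\<close>
  define x where "x = g + e - E"
  have E: "singular_chain (Suc k) ?Y E"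
  proof -
    have "continuous_map (prod_topology unit_interval ?S) ?Y (H \<circ> map_prod id (Pair 0))"
      by (intro continuous_map_compose[OF continuous_map_map_prod_id H] continuous_map_Pair_right) simp
    then show ?thesis
      unfolding E_def by (rule singular_chain_chain_map[OF singular_chain_prism[OF z]])
  qed
  have eq: "chain_map (Suc k) (wrap k) c + (e + e) = x + x + chain_boundary (Suc (Suc k)) G"
    unfolding bG g(2) x_def by (simp add: algebra_simps)
  have "chain_boundary (Suc k) (chain_map (Suc k) (wrap k) c) = - z - z"
    using chain_boundary_chain_map[OF c, of "wrap k"]
    by (simp add: bc chain_map_diff wP0[OF z] wP1[OF z] rz)
  then have "chain_boundary (Suc k) (chain_map (Suc k) (wrap k) c + (e + e)) = 0"
    by (simp add: chain_boundary_add be)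
  then have "chain_boundary (Suc k) x + chain_boundary (Suc k) x = 0"
    unfolding eq chain_boundary_add using chain_boundary_boundary_alt[OF G] by simp
  then have "singular_relcycle (Suc k) ?Y {} x"
    using frag_double_eq_0 g(1) e E unfolding x_def singular_cycle
    by (blast intro: singular_chain_add singular_chain_diff)
  \<comment> \<open>The cycle is sorted by hemispheres: \<open>u\<close> and \<open>e\<close> give
    its upper part, the reflection of \<open>u\<close> its lower part.\<close>
  moreover have "chain_map (Suc k) (wrap k) c + (e + e) =
      (chain_map (Suc k) (wrap k) (prism k u) + (e + e)) + - chain_map (Suc k) (wrap k) (prism k (chain_map k r u))"
    by (simp add: c_def zu prism_diff chain_map_diff)
  ultimately have "even_class (Suc k) ?Y
      ((chain_map (Suc k) (wrap k) (prism k u) + (e + e)) + - chain_map (Suc k) (wrap k) (prism k (chain_map k r u)))"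
    unfolding even_class_def using eq G by metis
  then have ev: "even_class k ?S (chain_boundary (Suc k) (chain_map (Suc k) (wrap k) (prism k u) + (e + e)))"
  proof (rule even_class_boundary_upper[rotated 2])
    have sin: "0 \<le> sin (pi * t)" if "t \<in> {0..1}" for t
      using that by (intro sin_ge_zero) (auto simp: mult_le_cancel_left1)
    show "singular_chain (Suc k) (subtopology ?Y {x. 0 \<le> x (Suc k)}) (chain_map (Suc k) (wrap k) (prism k u) + (e + e))"
      using sin by (intro singular_chain_add eU singular_chain_chain_map[OF singular_chain_prism[OF uU]]
          continuous_map_wrap_hemisphere) (auto simp: wrap_def)
    show "singular_chain (Suc k) (subtopology ?Y {x. x (Suc k) \<le> 0}) (- chain_map (Suc k) (wrap k) (prism k (chain_map k r u)))"
      unfolding singular_chain_minus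
      using sin by (intro singular_chain_chain_map[OF singular_chain_prism[OF ruL]]
          continuous_map_wrap_hemisphere) (auto simp: wrap_def mult_nonpos_nonneg)
  qed
  obtain l where l: "k = Suc l"
    using k by (cases k) auto
  then have l': "k - Suc 0 = l" by simp
  \<comment> \<open>\<open>D\<close> is swept by the equator of S^k. The last coordinate is 0 there,
    so \<open>wrap\<close> forgets the angle and \<open>D\<close> stays in the equator.\<close>
  define D where "D = chain_map k (wrap k) (prism l (chain_boundary k u))"
  have "chain_boundary (Suc k) (chain_map (Suc k) (wrap k) (prism k u)) = chain_map k r u - u - D"
    using chain_boundary_chain_map[OF singular_chain_prism[OF u], of "wrap k"]
    by (simp add: chain_boundary_prism[OF u] chain_map_diff wP0[OF u] wP1[OF u] D_def l')
  \<comment> \<open>Since \<open>z\<close> is \<open>u\<close> minus its reflection, the sum is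
    \<open>- z - D\<close> plus twice \<open>z\<close>.\<close>
  then have bA: "chain_boundary (Suc k) (chain_map (Suc k) (wrap k) (prism k u) + (e + e)) = z - D"
    by (simp add: chain_boundary_add be) (simp add: zu)
  have D: "singular_chain k (subtopology ?S {x. x k \<ge> 0}) D"
  proof -
    have bu: "singular_chain l (nsphere l) (chain_boundary k u)"
      by (simp add: l u_def chain_boundary_upper singular_chain_cmul singular_chain_sphere)
    have "continuous_map (prod_topology unit_interval (nsphere l)) (subtopology ?S {x. x k \<ge> 0}) (wrap k)"
    proof (rule continuous_map_eq)
      show "continuous_map (prod_topology unit_interval (nsphere l)) (subtopology ?S {x. x k \<ge> 0}) snd"
      proof -
        have "nsphere l = subtopology ?S {x. x k = 0}"
          unfolding l by (rule subtopology_nsphere_equator[symmetric])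
        then have "continuous_map (nsphere l) (subtopology ?S {x. x k \<ge> 0}) id"
          by (auto simp: continuous_map_in_subtopology continuous_map_from_subtopology)
        from continuous_map_compose[OF continuous_map_snd this] show ?thesis
          by (simp add: id_def o_def)
      qed
    qed (auto simp: wrap_def topspace_nsphere l)
    then show ?thesis
      unfolding D_def using singular_chain_chain_map[OF singular_chain_prism[OF bu]] by (simp add: l)
  qed
  have "chain_boundary k D = 0"
  proof -
    have "chain_boundary k (z - D) = 0"
      unfolding bA[symmetric]
      by (rule chain_boundary_boundary_alt[where X = ?Y])
        (intro singular_chain_add e singular_chain_chain_map[OF singular_chain_prism[OF u] continuous_map_wrap])
    then show ?thesis by (simp add: chain_boundary_diff bz)
  qed
  \<comment> \<open>A cycle of positive degree in a contractible hemisphere bounds; here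
    \<open>k \<ge> 1\<close> is needed.\<close>
  then have "singular_relboundary k (subtopology ?S {x. x k \<ge> 0}) {} D"
    using D k by (intro contractible_imp_cycle_boundary contractible_space_upper_hemisphere)
      (auto simp: singular_cycle)
  then have "singular_relboundary k ?S {} D"
    by (metis singular_boundary_mono subset_UNIV subtopology_UNIV)
  then have "even_class k ?S z"
    using even_class_add_boundary[OF ev[unfolded bA], of D] by simp
  then show False
    using sphere_chain_not_even by (simp add: z_def)
qed

subsection \<open>Equivariant sections\<close>

text \<open>Only the parameter of the path \<open>g\<close> moves, so local compactness of the
  interval suffices: a small closed interval around \<open>t\<close> has compact image
  \<open>K\<close> in \<open>J\<close>, and sending \<open>K\<close> into \<open>U\<close> is a
  subbasic open condition.\<close>

lemma continuous_map_compact_open_eval: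
  assumes s: "continuous_map C (compact_open_topology J X) s"
    and g: "continuous_map unit_interval J g"
  shows "continuous_map (prod_topology unit_interval C) X (\<lambda>w. s (snd w) (g (fst w)))"
proof -
  let ?P = "prod_topology unit_interval C"
  have sx: "s x \<in> extensional (topspace J)" "continuous_map J X (s x)" if "x \<in> topspace C" for x
    using s that by (auto simp: continuous_map_def topspace_compact_open_topology Pi_iff)
  show ?thesis
    unfolding continuous_map_def
  proof (intro conjI allI impI)
    show "(\<lambda>w. s (snd w) (g (fst w))) \<in> topspace ?P \<rightarrow> topspace X"
      using sx(2) g by (fastforce simp: continuous_map_def Pi_iff)
    fix U assume U: "openin X U"
    let ?V = "{w \<in> topspace ?P. s (snd w) (g (fst w)) \<in> U}"
    show "openin ?P ?V"
    proof (subst openin_subopen, intro ballI)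
      fix w assume w: "w \<in> ?V"
      obtain t x where tx: "w = (t, x)" by force
      have t: "t \<in> {0..1}" and x: "x \<in> topspace C" and tU: "s x (g t) \<in> U"
        using w tx by auto
      have "continuous_map unit_interval X (s x \<circ> g)"
        using continuous_map_compose[OF g sx(2)[OF x]] .
      then have "openin unit_interval {u \<in> {0..1}. s x (g u) \<in> U}"
        using U by (force simp: continuous_map_def)
      then obtain e where e: "e > 0" "cball t e \<inter> {0..1} \<subseteq> {u \<in> {0..1}. s x (g u) \<in> U}"
        using t tU unfolding openin_contains_cball by blast
      define K where "K = g ` (cball t e \<inter> {0..1})"
      have "compactin unit_interval (cball t e \<inter> {0..1})"
        by (simp add: compactin_subtopology compact_Int_closed)
      then have K: "compactin J K"
        unfolding K_def using g by (rule image_compactin)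
      define N where "N = {f \<in> extensional (topspace J). continuous_map J X f \<and> f ` K \<subseteq> U}"
      have "openin (compact_open_topology J X) N"
        unfolding compact_open_topology_def by (rule topology_generated_by_Basis) (use K U N_def in blast)
      then have N: "openin C {y \<in> topspace C. s y \<in> N}"
        using s by (simp add: continuous_map_def)
      have xN: "s x \<in> N"
        using sx[OF x] e(2) by (auto simp: N_def K_def)
      have "openin unit_interval (ball t e \<inter> {0..1})"
        by (metis Int_commute open_ball openin_open_Int)
      then have "openin ?P ((ball t e \<inter> {0..1}) \<times> {y \<in> topspace C. s y \<in> N})"
        using N by (simp add: openin_prod_Times_iff)
      moreover have "w \<in> (ball t e \<inter> {0..1}) \<times> {y \<in> topspace C. s y \<in> N}"
        using tx t x xN e(1) by simp
      moreover have "(ball t e \<inter> {0..1}) \<times> {y \<in> topspace C. s y \<in> N} \<subseteq> ?V"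
        by (auto simp: N_def K_def image_subset_iff)
      ultimately show "\<exists>T. openin ?P T \<and> w \<in> T \<and> T \<subseteq> ?V"
        by blast
    qed
  qed
qed

lemma continuous_map_branch_point:
  assumes "i \<in> {1..m}"
  shows "continuous_map unit_interval (star_space m) (branch_point i)"
proof -
  have "continuous_map (sum_topology (\<lambda>i. unit_interval) {1..m}) (star_space m) (\<lambda>(i, t). branch_point i t)"
    unfolding star_space_def by (rule quotient_imp_continuous_map[OF quotient_map_quotient_topology])
  from continuous_map_compose[OF continuous_map_component_injection[OF assms] this]
  show ?thesis by (simp add: o_def)
qed

section \<open>Regular polygons on great circles\<close>

definition wrap_normal :: "nat \<Rightarrow> real \<Rightarrow> nat \<Rightarrow> real" where
  "wrap_normal k u = (\<lambda>i. if i = k then - sin (pi * u) else if i = Suc k then cos (pi * u) else 0)"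

definition circle_point :: "nat \<Rightarrow> real \<Rightarrow> real \<times> (nat \<Rightarrow> real) \<Rightarrow> nat \<Rightarrow> real" where
  "circle_point k \<phi> w = (\<lambda>i. cos \<phi> * wrap k w i + sin \<phi> * wrap_normal k (fst w) i)"

text \<open>The shift by 1 gives the first vertex the angle 0, so that it is
  \<open>wrap k w\<close>.\<close>

definition polygon_angle :: "nat \<Rightarrow> nat \<Rightarrow> real" where
  "polygon_angle m i = 2 * pi * (real i - 1) / real m"

definition polygon :: "nat \<Rightarrow> nat \<Rightarrow> real \<times> (nat \<Rightarrow> real) \<Rightarrow> nat \<Rightarrow> nat \<Rightarrow> real" where
  "polygon m k w = (\<lambda>i\<in>{1..m}. circle_point k (polygon_angle m i) w)"

text \<open>Orthonormality of the two vectors in a single formula. With a cosine and a sine it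
  places the circle on the sphere; with differences of cosines and sines it separates the
  vertices.\<close>

lemma sum_squares_wrap_normal:
  assumes "y \<in> topspace (nsphere k)"
  shows "(\<Sum>i\<le>Suc k. (a * wrap k (u, y) i + b * wrap_normal k u i)\<^sup>2) = a\<^sup>2 + b\<^sup>2"
proof -
  define c s where "c = cos (pi * u)" and "s = sin (pi * u)"
  have cs: "s\<^sup>2 = 1 - c\<^sup>2" by (simp add: c_def s_def sin_squared_eq)
  have *: "(\<Sum>i\<le>k. g i) = (\<Sum>i<k. g i) + g k" for g :: "nat \<Rightarrow> real"
    by (simp add: lessThan_Suc_atMost[symmetric])
  have "(\<Sum>i\<le>Suc k. (a * wrap k (u, y) i + b * wrap_normal k u i)\<^sup>2) =
      a\<^sup>2 * (\<Sum>i<k. (y i)\<^sup>2) + (a * (y k * c) - b * s)\<^sup>2 + (a * (y k * s) + b * c)\<^sup>2"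
    by (simp add: * wrap_def wrap_normal_def power_mult_distrib sum_distrib_left c_def s_def)
  also have "\<dots> = a\<^sup>2 * (\<Sum>i\<le>k. (y i)\<^sup>2) + b\<^sup>2"
  proof -
    have "(a * (y k * c) - b * s)\<^sup>2 + (a * (y k * s) + b * c)\<^sup>2 = (a\<^sup>2 * (y k)\<^sup>2 + b\<^sup>2) * (s\<^sup>2 + c\<^sup>2)"
      by (simp add: power2_eq_square algebra_simps)
    then show ?thesis
      unfolding * cs by (simp add: distrib_left)
  qed
  finally show ?thesis
    using assms by (simp add: topspace_nsphere)
qed

lemma circle_point_in_nsphere:
  assumes "y \<in> topspace (nsphere k)"
  shows "circle_point k \<phi> (u, y) \<in> topspace (nsphere (Suc k))"
  using sum_squares_wrap_normal[OF assms, of "cos \<phi>" u "sin \<phi>"] assms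
  by (auto simp: circle_point_def topspace_nsphere wrap_def wrap_normal_def)

lemma continuous_map_circle_point:
  "continuous_map (prod_topology unit_interval (nsphere k)) (nsphere (Suc k)) (circle_point k \<phi>)"
proof (rule continuous_map_into_nsphere)
  fix i
  have 1: "continuous_map (prod_topology unit_interval (nsphere k)) euclideanreal fst"
    using continuous_map_fst continuous_map_in_subtopology by blast
  have "continuous_map euclideanreal euclideanreal (\<lambda>u. wrap_normal k u i)"
    unfolding wrap_normal_def by (cases "i = Suc k") (auto intro!: continuous_intros)
  from continuous_map_compose[OF 1 this]
  have "continuous_map (prod_topology unit_interval (nsphere k)) euclideanreal (\<lambda>w. wrap_normal k (fst w) i)"
    by (simp add: o_def)
  moreover have "continuous_map (prod_topology unit_interval (nsphere k)) euclideanreal (\<lambda>w. wrap k w i)"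
    using continuous_map_compose[OF continuous_map_wrap continuous_map_nsphere_projection] by (simp add: o_def)
  ultimately show "continuous_map (prod_topology unit_interval (nsphere k)) euclideanreal (\<lambda>w. circle_point k \<phi> w i)"
    unfolding circle_point_def by (intro continuous_intros)
qed (auto intro: circle_point_in_nsphere)

lemma polygon_angle_inj:
  assumes "i \<in> {1..m}" "j \<in> {1..m}"
    and "cos (polygon_angle m i) = cos (polygon_angle m j)" "sin (polygon_angle m i) = sin (polygon_angle m j)"
  shows "i = j"
proof -
  have m: "real m > 0" using assms(1) by auto
  obtain n :: int where "polygon_angle m i = polygon_angle m j + 2 * pi * n"
    using assms(3,4) sin_cos_eq_iff by metis
  then have "2 * pi * (real i - real j) = 2 * pi * (n * real m)"
    using m by (simp add: polygon_angle_def field_simps)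
  then have "real i - real j = n * real m"
    by (simp only: mult_cancel_left) simp
  then have n: "int i - int j = n * int m"
    by (metis of_int_diff of_int_eq_iff of_int_mult of_int_of_nat_eq)
  have "\<bar>int i - int j\<bar> < int m" using assms(1,2) by auto
  then have "n = 0"
    using m unfolding n by (simp add: abs_mult)
  then show ?thesis using n by simp
qed

lemma polygon_inj:
  assumes y: "y \<in> topspace (nsphere k)"
  shows "inj_on (polygon m k (u, y)) {1..m}"
proof (rule inj_onI)
  fix i j assume ij: "i \<in> {1..m}" "j \<in> {1..m}" and eq: "polygon m k (u, y) i = polygon m k (u, y) j"
  let ?a = "cos (polygon_angle m i) - cos (polygon_angle m j)"
  let ?b = "sin (polygon_angle m i) - sin (polygon_angle m j)"
  have "circle_point k (polygon_angle m i) (u, y) l = circle_point k (polygon_angle m j) (u, y) l" for l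
    using eq ij by (simp add: polygon_def)
  then have "?a * wrap k (u, y) l + ?b * wrap_normal k u l = 0" for l
    by (simp add: circle_point_def algebra_simps)
  then have "?a\<^sup>2 + ?b\<^sup>2 = 0"
    using sum_squares_wrap_normal[OF y, of ?a u ?b] by simp
  then show "i = j"
    using polygon_angle_inj[OF ij] by (simp add: sum_power2_eq_zero_iff)
qed

lemma continuous_map_polygon:
  "continuous_map (prod_topology unit_interval (nsphere k)) (configuration_space m (nsphere (Suc k))) (polygon m k)"
  unfolding configuration_space_def cartesian_power_def continuous_map_in_subtopology
proof
  show "continuous_map (prod_topology unit_interval (nsphere k))
      (product_topology (\<lambda>i. nsphere (Suc k)) {1..m}) (polygon m k)"
    unfolding continuous_map_componentwise
    by (auto simp: polygon_def continuous_map_circle_point[unfolded eta_contract_eq])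
qed (auto simp: polygon_inj[simplified])

lemma permutes_involution:
  assumes "\<And>x. p (p x) = x" "\<And>x. x \<notin> S \<Longrightarrow> p x = x"
  shows "p permutes S"
  unfolding permutes_def using assms by metis

text \<open>Both polygons start at the same point but have opposite normals, so angles are negated
  and vertex \<open>i\<close> becomes vertex \<open>m + 2 - i\<close>. That vertex 1 is fixed
  matters because the homotopy runs along branch 1.\<close>

lemma polygon_reflection:
  assumes "y \<in> topspace (nsphere k)"
  obtains \<sigma> where "\<sigma> permutes {1..m}" "\<sigma> 1 = 1"
    "polygon m k (1, y) = permute_coords \<sigma> (polygon m k (0, flip {k} y))"
proof
  define \<sigma> where "\<sigma> i = (if i \<in> {2..m} then m + 2 - i else i)" for i
  show "\<sigma> permutes {1..m}"
    by (rule permutes_involution) (auto simp: \<sigma>_def)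
  show "\<sigma> 1 = 1" by (simp add: \<sigma>_def)
  have cp: "circle_point k \<phi> (1, y) = circle_point k (- \<phi>) (0, flip {k} y)" for \<phi>
    using assms by (auto simp: circle_point_def wrap_def wrap_normal_def flip_def topspace_nsphere)
  have per: "circle_point k (2 * pi - \<phi>) w = circle_point k (- \<phi>) w" for \<phi> w
    by (simp add: circle_point_def cos_diff sin_diff)
  show "polygon m k (1, y) = permute_coords \<sigma> (polygon m k (0, flip {k} y))"
  proof
    fix i
    show "polygon m k (1, y) i = permute_coords \<sigma> (polygon m k (0, flip {k} y)) i"
    proof (cases "i \<in> {2..m}")
      case True
      then have "polygon_angle m (\<sigma> i) = 2 * pi - polygon_angle m i"
        by (simp add: polygon_angle_def \<sigma>_def of_nat_diff field_simps)
      moreover have "\<sigma> i \<in> {1..m}"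
        using True by (auto simp: \<sigma>_def)
      ultimately show ?thesis
        using True by (simp add: permute_coords_def polygon_def cp per)
    next
      case False
      then have "i = 1 \<or> i \<notin> {1..m}" by auto
      then show ?thesis
        using cp[of 0] by (auto simp: permute_coords_def polygon_def \<sigma>_def polygon_angle_def)
    qed
  qed
qed

text \<open>Negating \<open>y\<close> negates \<open>wrap\<close> and keeps the normal, so the angle
  \<open>\<phi>\<close> becomes \<open>pi - \<phi>\<close>. For \<open>m = 2 * h\<close> the angle
  \<open>pi\<close> is \<open>h\<close> steps, and \<open>i\<close> goes to \<open>h + 2 - i\<close>
  modulo \<open>m\<close>.\<close>

lemma polygon_antipodal:
  assumes "y \<in> topspace (nsphere k)" "even m"
  obtains \<tau> where "\<tau> permutes {1..m}"
    "polygon m k (u, flip {..k} y) = permute_coords \<tau> (polygon m k (u, y))"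
proof
  define h where "h = m div 2"
  have m: "m = 2 * h" using assms(2) by (simp add: h_def)
  define \<tau> where "\<tau> i = (if i \<in> {1..m} then if i \<le> h + 1 then h + 2 - i else m + h + 2 - i else i)" for i
  show "\<tau> permutes {1..m}"
    by (rule permutes_involution) (auto simp: \<tau>_def m)
  have cp: "circle_point k \<phi> (u, flip {..k} y) = circle_point k (pi - \<phi>) (u, y)" for \<phi>
    using assms(1) by (auto simp: circle_point_def wrap_def wrap_normal_def flip_def topspace_nsphere)
  have per: "circle_point k (\<phi> + 2 * pi) w = circle_point k \<phi> w" for \<phi> w
    by (simp add: circle_point_def)
  show "polygon m k (u, flip {..k} y) = permute_coords \<tau> (polygon m k (u, y))"
  proof
    fix i
    show "polygon m k (u, flip {..k} y) i = permute_coords \<tau> (polygon m k (u, y)) i"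
    proof (cases "i \<in> {1..m}")
      case True
      then have h: "real h > 0" using m by auto
      have \<tau>: "\<tau> i \<in> {1..m}"
        using True by (auto simp: \<tau>_def m)
      have "polygon_angle m (\<tau> i) = pi - polygon_angle m i \<or> polygon_angle m (\<tau> i) = pi - polygon_angle m i + 2 * pi"
        using True h by (auto simp: polygon_angle_def \<tau>_def of_nat_diff field_simps m)
      then have "circle_point k (polygon_angle m (\<tau> i)) (u, y) = circle_point k (pi - polygon_angle m i) (u, y)"
        using per by metis
      then show ?thesis
        using True \<tau> by (simp add: permute_coords_def polygon_def cp)
    qed (auto simp: permute_coords_def polygon_def \<tau>_def)
  qed
qed

theorem theorem1p10:
  fixes m n :: nat
  assumes "m \<ge> 4" and "even m" and "n \<ge> 2"
  shows "\<not> (\<exists>s. eps_equivariant_section m (nsphere n) s)"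
proof
  assume "\<exists>s. eps_equivariant_section m (nsphere n) s"
  then obtain s where s: "eps_equivariant_section m (nsphere n) s" ..
  obtain k where n: "n = Suc k" and k: "k \<ge> 1"
    using assms(3) by (cases n) auto
  let ?C = "configuration_space m (nsphere (Suc k))"
  let ?W = "prod_topology unit_interval (nsphere k)"
  have one: "1 \<in> {1..m}" using assms(1) by auto
  have cont: "continuous_map ?C (compact_open_topology (star_space m) (nsphere (Suc k))) s"
    and sec: "\<And>x. x \<in> topspace ?C \<Longrightarrow> endpoint_map m (s x) = x"
    and equi: "\<And>\<sigma> x. \<sigma> permutes {1..m} \<Longrightarrow> x \<in> topspace ?C \<Longrightarrow>
           s (permute_coords \<sigma> x) = permute_multipath m \<sigma> (s x)"
    using s unfolding eps_equivariant_section_def n eps_total_space_def multipath_space_def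
    by (auto simp: continuous_map_in_subtopology)
  have bp: "branch_point 1 t \<in> topspace (star_space m)" if "t \<in> {0..1}" for t
    using that one unfolding topspace_star_space by blast
  have perm: "s (permute_coords \<sigma> x) (branch_point 1 t) = s x (branch_point (\<sigma> 1) t)"
    if "\<sigma> permutes {1..m}" "x \<in> topspace ?C" "t \<in> {0..1}" for \<sigma> x t
    using equi[OF that(1,2)] bp[OF that(3)] by (simp add: permute_multipath_def)
  have P: "polygon m k (u, y) \<in> topspace ?C" if "u \<in> {0..1}" "y \<in> topspace (nsphere k)" for u y
    using continuous_map_polygon[of k m] that by (auto simp: continuous_map_def Pi_iff)
  have fl: "flip T y \<in> topspace (nsphere k)" if "y \<in> topspace (nsphere k)" for T y
    using continuous_map_flip[of k T] that by (auto simp: continuous_map_def Pi_iff)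
  \<comment> \<open>\<open>H\<close> follows branch 1 from the centre of the star to the first
    vertex.\<close>
  define H where "H = (\<lambda>(t, w). s (polygon m k w) (branch_point 1 t))"
  show False
  proof (rule no_symmetric_homotopy[OF k, of H])
    have "H = (\<lambda>w. s (snd w) (branch_point 1 (fst w))) \<circ> map_prod id (polygon m k)"
      by (auto simp: H_def)
    then show "continuous_map (prod_topology unit_interval ?W) (nsphere (Suc k)) H"
      using continuous_map_compose[OF continuous_map_map_prod_id[OF continuous_map_polygon]
          continuous_map_compact_open_eval[OF cont continuous_map_branch_point[OF one]]] by simp
  next
    fix t :: real and y assume t: "t \<in> {0..1}" and y: "y \<in> topspace (nsphere k)"
    obtain \<sigma> where \<sigma>: "\<sigma> permutes {1..m}" "\<sigma> 1 = 1"
      "polygon m k (1, y) = permute_coords \<sigma> (polygon m k (0, flip {k} y))"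
      using polygon_reflection[OF y] .
    show "H (t, 1, y) = H (t, 0, flip {k} y)"
      using perm[OF \<sigma>(1) P[of 0, OF _ fl[OF y, of "{k}"]] t] \<sigma>(2) by (simp add: H_def \<sigma>(3))
  next
    fix u :: real and y assume u: "u \<in> {0..1}" and y: "y \<in> topspace (nsphere k)"
    obtain \<tau> where \<tau>: "\<tau> permutes {1..m}"
      "polygon m k (u, flip {..k} y) = permute_coords \<tau> (polygon m k (u, y))"
      using polygon_antipodal[OF y assms(2)] .
    \<comment> \<open>All branches meet at parameter 0, so it is harmless that \<open>\<tau>\<close>
      moves branch 1.\<close>
    show "H (0, u, flip {..k} y) = H (0, u, y)"
      using perm[OF \<tau>(1) P[OF u y], of 0] by (simp add: H_def \<tau>(2) branch_point_def)
    show "H (1, u, y) = wrap k (u, y)"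
    proof -
      have "H (1, u, y) = endpoint_map m (s (polygon m k (u, y))) 1"
        using one by (simp add: H_def endpoint_map_def)
      also have "\<dots> = polygon m k (u, y) 1"
        using sec[OF P[OF u y]] by simp
      also have "\<dots> = wrap k (u, y)"
        using one by (simp add: polygon_def polygon_angle_def circle_point_def)
      finally show ?thesis .
    qed
  qed
qed

end
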